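(* Let $p$ be a prime number and let $G$ be a finite group whose order is $2p$, $p$, or $p^2$. For $\alpha \in \mathrm{Aut}(G)$ let $S_{\alpha} = \{g \in G \mid \alpha(g) = g^{-1}\}$. Then $T(G) \geq |S_{\alpha}|$ for all $\alpha \in \mathrm{Aut}(G)$.
   Context: For a finite group $G$, $\mathrm{Aut}(G)$ denotes its automorphism group and $T(G)$ denotes the sum of the degrees of the irreducible complex representations of $G$ (one from each isomorphism class). *)

theory Defs
  imports
    "HOL-Algebra.Bij"
    "HOL-Computational_Algebra.Primes"
    "Jordan_Normal_Form.VS_Connect"
begin

definition GL :: "nat \<Rightarrow> complex mat monoid" where
  "GL n = units_of (ring_mat TYPE(complex) n ())"

definition invariant_subspace ::
  "('a, 'b) monoid_scheme \<Rightarrow> nat \<Rightarrow> ('a \<Rightarrow> complex mat) \<Rightarrow> complex vec set \<Rightarrow> bool" where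
  "invariant_subspace G n \<rho> W \<longleftrightarrow>
     VectorSpace.subspace class_ring W (module_vec TYPE(complex) n) \<and>
     (\<forall>g\<in>carrier G. \<forall>w\<in>W. \<rho> g *\<^sub>v w \<in> W)"

definition irreducible_rep ::
  "('a, 'b) monoid_scheme \<Rightarrow> nat \<Rightarrow> ('a \<Rightarrow> complex mat) \<Rightarrow> bool" where
  "irreducible_rep G n \<rho> \<longleftrightarrow>
     \<rho> \<in> hom G (GL n) \<and> n > 0 \<and>
     (\<forall>W. invariant_subspace G n \<rho> W \<longrightarrow> W = {0\<^sub>v n} \<or> W = carrier_vec n)"

text \<open>
  A finite-dimensional complex representation is given, after a choice of basis, by its degree
  together with a homomorphism into the general linear group of that degree. Isomorphism of
  representations is then the existence of an invertible intertwining matrix.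
\<close>

definition irreps :: "('a, 'b) monoid_scheme \<Rightarrow> (nat \<times> ('a \<Rightarrow> complex mat)) set" where
  "irreps G = {(n, \<rho>). irreducible_rep G n \<rho>}"

definition rep_iso ::
  "('a, 'b) monoid_scheme \<Rightarrow> ((nat \<times> ('a \<Rightarrow> complex mat)) \<times> (nat \<times> ('a \<Rightarrow> complex mat))) set" where
  "rep_iso G = {((n, \<rho>), (m, \<sigma>)).
     (n, \<rho>) \<in> irreps G \<and> (m, \<sigma>) \<in> irreps G \<and> n = m \<and>
     (\<exists>P\<in>carrier (GL n). \<forall>g\<in>carrier G. P * \<rho> g = \<sigma> g * P)}"

text \<open>
  All members of an isomorphism class \<open>C\<close> have the same degree, so \<open>fst ` C\<close> is a singleton.
  The values of \<open>\<rho>\<close> outside the carrier are irrelevant: maps agreeing on the carrier lie in the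
  same class. The sum is over a finite set when \<open>G\<close> is finite.
\<close>

definition T :: "('a, 'b) monoid_scheme \<Rightarrow> nat" where
  "T G = (\<Sum>C \<in> irreps G // rep_iso G. the_elem (fst ` C))"

lemma GL_simps:
  "carrier (GL n) = Units (ring_mat TYPE(complex) n ())"
  "mult (GL n) = (*)"
  "one (GL n) = 1\<^sub>m n"
  by (simp_all add: GL_def units_of_def ring_mat_simps)

lemma GL_carrier:
  "P \<in> carrier (GL n) \<longleftrightarrow>
     P \<in> carrier_mat n n \<and> (\<exists>Q\<in>carrier_mat n n. Q * P = 1\<^sub>m n \<and> P * Q = 1\<^sub>m n)"
  by (auto simp: GL_simps Units_def ring_mat_simps)

lemma irreps_carrier:
  assumes "(n, \<rho>) \<in> irreps G" "g \<in> carrier G"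
  shows "\<rho> g \<in> carrier_mat n n"
  using assms by (auto simp: irreps_def irreducible_rep_def hom_def GL_carrier)

lemma rep_isoE:
  assumes "((n, \<rho>), (m, \<sigma>)) \<in> rep_iso G"
  obtains P where "m = n" "(n, \<rho>) \<in> irreps G" "(n, \<sigma>) \<in> irreps G"
    "P \<in> carrier (GL n)" "\<forall>g\<in>carrier G. P * \<rho> g = \<sigma> g * P"
  using assms unfolding rep_iso_def by blast

lemma rep_isoI:
  assumes "(n, \<rho>) \<in> irreps G" "(n, \<sigma>) \<in> irreps G"
    "P \<in> carrier (GL n)" "\<And>g. g \<in> carrier G \<Longrightarrow> P * \<rho> g = \<sigma> g * P"
  shows "((n, \<rho>), (n, \<sigma>)) \<in> rep_iso G"
  using assms unfolding rep_iso_def by blast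

lemma equiv_rep_iso: "equiv (irreps G) (rep_iso G)"
proof (rule equivI)
  show "rep_iso G \<subseteq> irreps G \<times> irreps G"
    by (auto simp: rep_iso_def)
  show "refl_on (irreps G) (rep_iso G)"
  proof (rule refl_onI, clarify)
    fix n \<rho> assume r: "(n, \<rho>) \<in> irreps G"
    have "1\<^sub>m n \<in> carrier (GL n)"
      unfolding GL_carrier by (auto intro!: bexI[of _ "1\<^sub>m n"])
    moreover have "1\<^sub>m n * \<rho> g = \<rho> g * 1\<^sub>m n" if "g \<in> carrier G" for g
      using irreps_carrier[OF r that] by simp
    ultimately show "((n, \<rho>), (n, \<rho>)) \<in> rep_iso G"
      by (intro rep_isoI[OF r r])
  qed
  show "sym (rep_iso G)"
  proof (rule symI, clarify)
    fix n \<rho> m \<sigma> assume "((n, \<rho>), (m, \<sigma>)) \<in> rep_iso G"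
    then obtain P where mn: "m = n" and r: "(n, \<rho>) \<in> irreps G" and s: "(n, \<sigma>) \<in> irreps G"
      and P: "P \<in> carrier (GL n)" and PI: "\<forall>g\<in>carrier G. P * \<rho> g = \<sigma> g * P"
      by (rule rep_isoE)
    from P obtain Q where Pc: "P \<in> carrier_mat n n" and Qc: "Q \<in> carrier_mat n n"
      and QP: "Q * P = 1\<^sub>m n" and PQ: "P * Q = 1\<^sub>m n"
      unfolding GL_carrier by blast
    have Q: "Q \<in> carrier (GL n)"
      unfolding GL_carrier using Pc Qc QP PQ by blast
    have "Q * \<sigma> g = \<rho> g * Q" if g: "g \<in> carrier G" for g
    proof -
      note rc = irreps_carrier[OF r g] and sc = irreps_carrier[OF s g]
      have "Q * \<sigma> g = Q * (\<sigma> g * (P * Q))"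
        unfolding PQ using sc by simp
      also have "\<sigma> g * (P * Q) = \<sigma> g * P * Q"
        by (rule assoc_mult_mat[OF sc Pc Qc, symmetric])
      also have "\<sigma> g * P = P * \<rho> g"
        using PI g by simp
      also have "P * \<rho> g * Q = P * (\<rho> g * Q)"
        by (rule assoc_mult_mat[OF Pc rc Qc])
      also have "Q * (P * (\<rho> g * Q)) = Q * P * (\<rho> g * Q)"
        by (rule assoc_mult_mat[OF Qc Pc mult_carrier_mat[OF rc Qc], symmetric])
      also have "\<dots> = \<rho> g * Q"
        unfolding QP by (rule left_mult_one_mat[OF mult_carrier_mat[OF rc Qc]])
      finally show ?thesis .
    qed
    then show "((m, \<sigma>), (n, \<rho>)) \<in> rep_iso G"
      unfolding mn by (intro rep_isoI[OF s r Q])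
  qed
  show "trans (rep_iso G)"
  proof (rule transI, clarify)
    fix n \<rho> m \<sigma> k \<tau>
    assume 1: "((n, \<rho>), (m, \<sigma>)) \<in> rep_iso G" and 2: "((m, \<sigma>), (k, \<tau>)) \<in> rep_iso G"
    from 1 obtain P where mn: "m = n" and r: "(n, \<rho>) \<in> irreps G" and s: "(n, \<sigma>) \<in> irreps G"
      and P: "P \<in> carrier (GL n)" and PI: "\<forall>g\<in>carrier G. P * \<rho> g = \<sigma> g * P"
      by (rule rep_isoE)
    from 2[unfolded mn] obtain Q where kn: "k = n" and t: "(n, \<tau>) \<in> irreps G"
      and Q: "Q \<in> carrier (GL n)" and QI: "\<forall>g\<in>carrier G. Q * \<sigma> g = \<tau> g * Q"
      by (rule rep_isoE)
    have Pc: "P \<in> carrier_mat n n" and Qc: "Q \<in> carrier_mat n n"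
      using P Q unfolding GL_carrier by blast+
    interpret R: ring "ring_mat TYPE(complex) n ()" by (rule ring_mat)
    have QP: "Q * P \<in> carrier (GL n)"
      using R.Units_m_closed[of Q P] P Q by (simp add: GL_simps ring_mat_simps)
    have "Q * P * \<rho> g = \<tau> g * (Q * P)" if g: "g \<in> carrier G" for g
    proof -
      note rc = irreps_carrier[OF r g] and sc = irreps_carrier[OF s g]
        and tc = irreps_carrier[OF t g]
      have "Q * P * \<rho> g = Q * (P * \<rho> g)"
        by (rule assoc_mult_mat[OF Qc Pc rc])
      also have "P * \<rho> g = \<sigma> g * P"
        using PI g by simp
      also have "Q * (\<sigma> g * P) = Q * \<sigma> g * P"
        by (rule assoc_mult_mat[OF Qc sc Pc, symmetric])
      also have "Q * \<sigma> g = \<tau> g * Q"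
        using QI g by simp
      also have "\<tau> g * Q * P = \<tau> g * (Q * P)"
        by (rule assoc_mult_mat[OF tc Qc Pc])
      finally show ?thesis .
    qed
    then show "((n, \<rho>), (k, \<tau>)) \<in> rep_iso G"
      unfolding kn by (intro rep_isoI[OF r t QP])
  qed
qed

lemma degree_of_class:
  assumes "(n, \<rho>) \<in> irreps G"
  shows "the_elem (fst ` (rep_iso G `` {(n, \<rho>)})) = n"
proof -
  have "((n, \<rho>), (n, \<rho>)) \<in> rep_iso G"
    using equiv_rep_iso[of G] assms by (auto simp: equiv_def refl_on_def)
  hence "fst ` (rep_iso G `` {(n, \<rho>)}) = {n}"
    by (force simp: rep_iso_def)
  thus ?thesis by simp
qed

end

theory Submission
  imports Defs "HOL-Algebra.Sylow" "HOL-Algebra.Multiplicative_Group"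
    "Jordan_Normal_Form.Spectral_Radius"
begin

text \<open>
  For an abelian group \<open>T(G) \<ge> |G|\<close>, because extending characters step by step along a chain of
  subgroups yields \<open>|G|\<close> linear characters; groups of order \<open>p\<close> and \<open>p\<^sup>2\<close> are abelian. A non-abelian group
  of order \<open>2p\<close> has a subgroup \<open>C\<close> of order \<open>p\<close> outside which every element is an involution. Its two
  linear characters and the \<open>(p - 1) / 2\<close> representations induced from powers of a nontrivial character of
  \<open>C\<close> give \<open>T(G) \<ge> p + 1\<close>. An automorphism cannot both invert a nontrivial element of \<open>C\<close> and fix two
  involutions, so it inverts at most \<open>p + 1\<close> elements.
\<close>

section \<open>Irreducible representations of a finite group\<close>

text \<open>Both estimates are sharp. For abelian \<open>G\<close> inversion is itself an
  automorphism, so the bound must be the full order; for dihedral \<open>G\<close> of order 2p with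
  p odd, the identity inverts \<open>\<one>\<close> and the p involutions, so p + 1 cannot be
  lowered either. The supply of representations must therefore be exact in number, but the argument
  may stay one-sided: enough pairwise non-isomorphic irreducible representations suffice, and
  neither completeness of the list nor the sum of the squared degrees is used. From the general
  theory there remain Schur's lemma and just enough orthogonality to bound the number of
  classes.\<close>

lemma invariant_subspaceI:
  assumes "W \<subseteq> carrier_vec n" "0\<^sub>v n \<in> W"
    and "\<And>v w. v \<in> W \<Longrightarrow> w \<in> W \<Longrightarrow> v + w \<in> W"
    and "\<And>c v. v \<in> W \<Longrightarrow> c \<cdot>\<^sub>v v \<in> W"
    and "\<And>g v. g \<in> carrier G \<Longrightarrow> v \<in> W \<Longrightarrow> \<rho> g *\<^sub>v v \<in> W"
  shows "invariant_subspace G n \<rho> W"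
  unfolding invariant_subspace_def VectorSpace.subspace_def submodule_def module_vec_simps
  using assms vec_vs[of n] vec_module[of n] by auto

lemma invariant_subspaceD:
  assumes "invariant_subspace G n \<rho> W"
  shows "W \<subseteq> carrier_vec n" "0\<^sub>v n \<in> W"
    and "\<And>v w. v \<in> W \<Longrightarrow> w \<in> W \<Longrightarrow> v + w \<in> W"
    and "\<And>c v. v \<in> W \<Longrightarrow> c \<cdot>\<^sub>v v \<in> W"
    and "\<And>g v. g \<in> carrier G \<Longrightarrow> v \<in> W \<Longrightarrow> \<rho> g *\<^sub>v v \<in> W"
  using assms
  unfolding invariant_subspace_def VectorSpace.subspace_def submodule_def module_vec_simps
  by auto

lemma GL_group: "group (GL n)"
proof -
  interpret R: ring "ring_mat TYPE(complex) n ()" by (rule ring_mat)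
  show ?thesis unfolding GL_def by (rule R.units_group)
qed

lemma GL_hom:
  assumes "\<rho> \<in> hom G (GL n)"
  shows "\<And>g. g \<in> carrier G \<Longrightarrow> \<rho> g \<in> carrier_mat n n"
    and "\<And>g h. g \<in> carrier G \<Longrightarrow> h \<in> carrier G \<Longrightarrow> \<rho> (g \<otimes>\<^bsub>G\<^esub> h) = \<rho> g * \<rho> h"
    and "group G \<Longrightarrow> \<rho> \<one>\<^bsub>G\<^esub> = 1\<^sub>m n"
  using assms hom_one[OF assms _ GL_group] by (auto simp: hom_def GL_carrier GL_simps(2,3))

section \<open>Schur's lemma\<close>

lemma mat_mult_unit_vec:
  fixes A :: "'a :: comm_semiring_1 mat"
  assumes "A \<in> carrier_mat n m" "j < m"
  shows "A *\<^sub>v unit_vec m j = col A j"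
  using assms by (intro eq_vecI) auto

text \<open>The kernel of \<open>A\<close> is invariant under \<open>\<sigma>\<close> and its range
  under \<open>\<rho>\<close>; as \<open>A\<close> is nonzero, irreducibility makes the kernel
  trivial and the range everything. Rectangular \<open>A\<close> lets one statement serve both the
  comparison of two representations and the matrices commuting with one.\<close>

lemma schur:
  assumes r: "irreducible_rep G n \<rho>" and s: "irreducible_rep G m \<sigma>"
    and A: "A \<in> carrier_mat n m" and nz: "A \<noteq> 0\<^sub>m n m"
    and intertw: "\<And>g. g \<in> carrier G \<Longrightarrow> \<rho> g * A = A * \<sigma> g"
  obtains B where "m = n" "B \<in> carrier_mat n n" "A * B = 1\<^sub>m n" "B * A = 1\<^sub>m n"
proof -
  note rc = GL_hom(1)[OF conjunct1[OF r[unfolded irreducible_rep_def]]]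
  note sc = GL_hom(1)[OF conjunct1[OF s[unfolded irreducible_rep_def]]]
  have act: "\<rho> g *\<^sub>v (A *\<^sub>v v) = A *\<^sub>v (\<sigma> g *\<^sub>v v)"
    if "g \<in> carrier G" "v \<in> carrier_vec m" for g v
    using intertw[OF that(1)] assoc_mult_mat_vec[OF rc[OF that(1)] A that(2)]
      assoc_mult_mat_vec[OF A sc[OF that(1)] that(2)] by simp
  define K where "K = {v \<in> carrier_vec m. A *\<^sub>v v = 0\<^sub>v n}"
  define R where "R = {A *\<^sub>v v |v. v \<in> carrier_vec m}"
  have "\<exists>j<m. A *\<^sub>v unit_vec m j \<noteq> 0\<^sub>v n"
  proof (rule ccontr)
    assume "\<not> ?thesis"
    hence *: "A *\<^sub>v unit_vec m j = 0\<^sub>v n" if "j < m" for j using that by blast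
    have "A = 0\<^sub>m n m"
      using A * by (intro mat_col_eqI) (auto simp: mat_mult_unit_vec[OF A, symmetric])
    with nz show False ..
  qed
  then obtain j where j: "j < m" "A *\<^sub>v unit_vec m j \<noteq> 0\<^sub>v n" by blast
  have "invariant_subspace G m \<sigma> K"
  proof (rule invariant_subspaceI)
    fix g v assume g: "g \<in> carrier G" and v: "v \<in> K"
    have "\<rho> g *\<^sub>v (A *\<^sub>v v) = 0\<^sub>v n" using v rc[OF g] by (auto simp: K_def)
    thus "\<sigma> g *\<^sub>v v \<in> K" using act[OF g, of v] sc[OF g] v by (auto simp: K_def)
  qed (use A in \<open>auto simp: K_def mult_add_distrib_mat_vec mult_mat_vec\<close>)
  hence "K = {0\<^sub>v m} \<or> K = carrier_vec m"
    using s unfolding irreducible_rep_def by blast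
  moreover have "unit_vec m j \<notin> K" using j by (simp add: K_def)
  ultimately have K: "K = {0\<^sub>v m}" by auto
  have "invariant_subspace G n \<rho> R"
  proof (rule invariant_subspaceI)
    show "R \<subseteq> carrier_vec n" using A by (auto simp: R_def)
    show "0\<^sub>v n \<in> R" unfolding R_def using A by (auto intro!: exI[of _ "0\<^sub>v m"])
    show "v + w \<in> R" if "v \<in> R" "w \<in> R" for v w
      using that unfolding R_def
      by (auto intro: add_carrier_vec mult_add_distrib_mat_vec[OF A, symmetric])
    show "c \<cdot>\<^sub>v v \<in> R" if "v \<in> R" for c v
      using that unfolding R_def
      by (auto intro: smult_carrier_vec mult_mat_vec[OF A, symmetric])
    show "\<rho> g *\<^sub>v v \<in> R" if "g \<in> carrier G" "v \<in> R" for g v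
      using that act sc unfolding R_def by fastforce
  qed
  hence "R = {0\<^sub>v n} \<or> R = carrier_vec n"
    using r unfolding irreducible_rep_def by blast
  moreover have "A *\<^sub>v unit_vec m j \<in> R" by (auto simp: R_def)
  ultimately have R: "R = carrier_vec n" using j by auto
  have "\<exists>w \<in> carrier_vec m. A *\<^sub>v w = v" if "v \<in> carrier_vec n" for v
  proof -
    have "v \<in> R" using that R by simp
    thus ?thesis by (auto simp: R_def)
  qed
  then obtain f where f: "\<And>v. v \<in> carrier_vec n \<Longrightarrow> f v \<in> carrier_vec m"
    "\<And>v. v \<in> carrier_vec n \<Longrightarrow> A *\<^sub>v f v = v" by metis
  \<comment> \<open>Preimages of the unit vectors, taken as columns, form a right inverse of
    \<open>A\<close>; injectivity of \<open>A\<close> makes it a left inverse too.\<close>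
  define B where "B = mat_of_cols m (map (\<lambda>j. f (unit_vec n j)) [0..<n])"
  have B: "B \<in> carrier_mat m n" unfolding B_def by (auto simp: mat_of_cols_def)
  have colB: "col B j = f (unit_vec n j)" if "j < n" for j
    using that f unfolding B_def by (subst col_mat_of_cols) auto
  have AB: "A * B = 1\<^sub>m n"
  proof (rule mat_col_eqI)
    fix i assume "i < dim_col (1\<^sub>m n)"
    hence i: "i < n" by simp
    have "col (A * B) i = A *\<^sub>v col B i" by (rule col_mult2[OF A B i])
    also have "\<dots> = col (1\<^sub>m n) i" using i f by (simp add: colB)
    finally show "col (A * B) i = col (1\<^sub>m n) i" .
  qed (use A B in auto)
  have BA: "B * A = 1\<^sub>m m"
  proof (rule mat_col_eqI)
    fix i assume "i < dim_col (1\<^sub>m m)"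
    hence i: "i < m" by simp
    define a where "a = col A i"
    have a: "a \<in> carrier_vec n" using A by (auto simp: a_def)
    have "A *\<^sub>v (B *\<^sub>v a) = a"
      using assoc_mult_mat_vec[OF A B a] AB a by simp
    also have "\<dots> = A *\<^sub>v unit_vec m i"
      using mat_mult_unit_vec[OF A i] by (simp add: a_def)
    finally have "A *\<^sub>v (B *\<^sub>v a - unit_vec m i) = 0\<^sub>v n"
      using A B a by (subst mult_minus_distrib_mat_vec[OF A]) auto
    moreover have "B *\<^sub>v a - unit_vec m i \<in> carrier_vec m" using B a by auto
    ultimately have "B *\<^sub>v a - unit_vec m i = 0\<^sub>v m"
      using K unfolding K_def by blast
    hence "B *\<^sub>v a = unit_vec m i"
      using B a by (intro eq_vecI) (auto simp: vec_eq_iff)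
    moreover have "col (B * A) i = B *\<^sub>v a"
      unfolding a_def by (rule col_mult2[OF B A i])
    ultimately show "col (B * A) i = col (1\<^sub>m m) i" using i by simp
  qed (use A B in auto)
  \<comment> \<open>Instead of a dimension count, the traces of \<open>A * B\<close> and
    \<open>B * A\<close> are compared.\<close>
  have "of_nat n = (\<Sum>i<n. (A * B) $$ (i,i))" by (simp add: AB)
  also have "\<dots> = (\<Sum>i<n. \<Sum>k<m. A $$ (i,k) * B $$ (k,i))"
    using A B by (auto simp: scalar_prod_def atLeast0LessThan)
  also have "\<dots> = (\<Sum>k<m. \<Sum>i<n. A $$ (i,k) * B $$ (k,i))" by (rule sum.swap)
  also have "\<dots> = (\<Sum>k<m. (B * A) $$ (k,k))"
    using A B by (auto simp: scalar_prod_def atLeast0LessThan mult.commute)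
  also have "\<dots> = of_nat m" by (simp add: BA)
  finally have "m = n" by (simp only: of_nat_eq_iff)
  with AB BA B that show thesis by blast
qed

section \<open>Averaging over the group and orthogonality of matrix coefficients\<close>

lemma index_mult_mat_sum:
  assumes "A \<in> carrier_mat n k" "B \<in> carrier_mat k m" "i < n" "j < m"
  shows "(A * B) $$ (i, j) = (\<Sum>c<k. A $$ (i, c) * B $$ (c, j))"
  using assms by (auto simp: scalar_prod_def atLeast0LessThan)

text \<open>
  The sum over \<open>g\<close> of \<open>\<rho>(g) E \<sigma>(g\<^sup>-\<^sup>1)\<close>, where \<open>E\<close> has the single nonzero entry \<open>1\<close> in position \<open>(0, 0)\<close>.
\<close>

definition average :: "('a, 'b) monoid_scheme \<Rightarrow> nat \<Rightarrow> ('a \<Rightarrow> complex mat) \<Rightarrow> nat \<Rightarrow>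
    ('a \<Rightarrow> complex mat) \<Rightarrow> complex mat" where
  "average G n \<rho> m \<sigma> =
     mat n m (\<lambda>(i, j). \<Sum>g\<in>carrier G. \<rho> g $$ (i, 0) * \<sigma> (inv\<^bsub>G\<^esub> g) $$ (0, j))"

lemma average_intertwines:
  fixes G (structure)
  assumes "group G" and \<rho>: "\<rho> \<in> hom G (GL n)" and \<sigma>: "\<sigma> \<in> hom G (GL m)"
    and pos: "0 < n" "0 < m" and h: "h \<in> carrier G"
  shows "\<rho> h * average G n \<rho> m \<sigma> = average G n \<rho> m \<sigma> * \<sigma> h" (is "_ * ?A = _")
proof (rule eq_matI)
  interpret group G by fact
  note r = GL_hom(1)[OF \<rho>] and s = GL_hom(1)[OF \<sigma>]
  have A: "?A \<in> carrier_mat n m" by (simp add: average_def)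
  fix i j assume "i < dim_row (?A * \<sigma> h)" "j < dim_col (?A * \<sigma> h)"
  hence i: "i < n" and j: "j < m" using A s[OF h] by auto
  have "(\<rho> h * ?A) $$ (i, j) = (\<Sum>c<n. \<rho> h $$ (i, c) *
      (\<Sum>g\<in>carrier G. \<rho> g $$ (c, 0) * \<sigma> (inv g) $$ (0, j)))"
    using i j by (subst index_mult_mat_sum[OF r[OF h] A]) (auto simp: average_def)
  also have "\<dots> = (\<Sum>g\<in>carrier G. (\<Sum>c<n. \<rho> h $$ (i, c) * \<rho> g $$ (c, 0)) * \<sigma> (inv g) $$ (0, j))"
    by (simp add: sum_distrib_left sum_distrib_right mult.assoc sum.swap[of _ "carrier G"])
  also have "\<dots> = (\<Sum>g\<in>carrier G. \<rho> (h \<otimes> g) $$ (i, 0) * \<sigma> (inv g) $$ (0, j))"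
    using h i pos by (intro sum.cong refl)
      (simp add: GL_hom(2)[OF \<rho>] index_mult_mat_sum[OF r r])
  \<comment> \<open>Substituting \<open>inv h \<otimes> g\<close> for \<open>g\<close> moves the
    factor \<open>h\<close> from the argument of \<open>\<rho>\<close> to that of
    \<open>\<sigma>\<close>.\<close>
  also have "\<dots> = (\<Sum>g\<in>carrier G. \<rho> g $$ (i, 0) * \<sigma> (inv g \<otimes> h) $$ (0, j))"
    by (rule sum.reindex_bij_witness[of _ "\<lambda>g. inv h \<otimes> g" "\<lambda>g. h \<otimes> g"])
      (use h in \<open>auto simp: inv_mult_group m_assoc[symmetric]\<close>, auto simp: m_assoc)
  also have "\<dots> = (\<Sum>g\<in>carrier G. \<rho> g $$ (i, 0) * (\<Sum>c<m. \<sigma> (inv g) $$ (0, c) * \<sigma> h $$ (c, j)))"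
    using h j pos by (intro sum.cong refl)
      (simp add: GL_hom(2)[OF \<sigma>] index_mult_mat_sum[OF s s])
  also have "\<dots> = (\<Sum>c<m. (\<Sum>g\<in>carrier G. \<rho> g $$ (i, 0) * \<sigma> (inv g) $$ (0, c)) * \<sigma> h $$ (c, j))"
    by (simp add: sum_distrib_left sum_distrib_right mult.assoc sum.swap[of _ "carrier G"])
  also have "\<dots> = (?A * \<sigma> h) $$ (i, j)"
    using i j by (subst index_mult_mat_sum[OF A s[OF h]]) (auto simp: average_def)
  finally show "(\<rho> h * ?A) $$ (i, j) = (?A * \<sigma> h) $$ (i, j)" .
qed (use GL_hom(1)[OF \<rho> h] GL_hom(1)[OF \<sigma> h] in \<open>auto simp: average_def\<close>)

text \<open>The sum is the \<open>(0, 0)\<close> entry of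
  \<open>average G n \<rho> m \<sigma>\<close>; were it nonzero, Schur's lemma would turn that
  matrix into an isomorphism.\<close>

lemma matrix_coeff_orthogonal:
  fixes G (structure)
  assumes "group G" and r: "(n, \<rho>) \<in> irreps G" and s: "(m, \<sigma>) \<in> irreps G"
    and ni: "((n, \<rho>), (m, \<sigma>)) \<notin> rep_iso G"
  shows "(\<Sum>g\<in>carrier G. \<rho> g $$ (0, 0) * \<sigma> (inv g) $$ (0, 0)) = 0"
proof (rule ccontr)
  assume nz: "\<not> ?thesis"
  have r': "irreducible_rep G n \<rho>" and s': "irreducible_rep G m \<sigma>"
    using r s by (auto simp: irreps_def)
  hence hom: "\<rho> \<in> hom G (GL n)" "\<sigma> \<in> hom G (GL m)" "0 < n" "0 < m"
    by (auto simp: irreducible_rep_def)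
  let ?A = "average G n \<rho> m \<sigma>"
  have A: "?A \<in> carrier_mat n m" by (simp add: average_def)
  have "?A \<noteq> 0\<^sub>m n m" using nz hom by (auto simp: average_def dest!: arg_cong[of _ _ "\<lambda>M. M $$ (0,0)"])
  from schur[OF r' s' A this average_intertwines[OF \<open>group G\<close> hom]] obtain B where
    B: "m = n" "B \<in> carrier_mat n n" "?A * B = 1\<^sub>m n" "B * ?A = 1\<^sub>m n" by blast
  hence A': "?A \<in> carrier (GL n)" "B \<in> carrier (GL n)" using A by (auto simp: GL_carrier)
  have "((m, \<sigma>), (n, \<rho>)) \<in> rep_iso G"
    using rep_isoI[OF _ r A'(1), of \<sigma>] average_intertwines[OF \<open>group G\<close> hom] s B(1) by metis
  with ni equiv_rep_iso[of G] show False by (auto simp: equiv_def dest: symD)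
qed

text \<open>The average for \<open>\<rho>\<close> against itself commutes with every
  \<open>\<rho> g\<close>, so it is a scalar \<open>c\<close>. Each of its summands is a conjugate
  of a matrix of trace 1, hence \<open>n\<close> times \<open>c\<close> is the group order.\<close>

lemma matrix_coeff_norm:
  fixes G (structure)
  assumes "group G" and r: "(n, \<rho>) \<in> irreps G"
  shows "of_nat n * (\<Sum>g\<in>carrier G. \<rho> g $$ (0, 0) * \<rho> (inv g) $$ (0, 0)) = of_nat (Coset.order G)"
proof -
  interpret group G by fact
  have r': "irreducible_rep G n \<rho>" using r by (auto simp: irreps_def)
  hence hom: "\<rho> \<in> hom G (GL n)" "0 < n" by (auto simp: irreducible_rep_def)
  note rc = GL_hom(1)[OF hom(1)]
  let ?A = "average G n \<rho> n \<rho>"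
  have A: "?A \<in> carrier_mat n n" by (simp add: average_def)
  \<comment> \<open>Over the complex numbers an eigenvalue exists since \<open>n > 0\<close>;
    subtracting it makes the matrix singular, and Schur's lemma allows this only for the zero
    matrix.\<close>
  obtain c v where v: "eigenvector ?A v c"
    using spectrum_non_empty[OF A hom(2)] by (auto simp: spectrum_def eigenvalue_def)
  hence v: "v \<in> carrier_vec n" "v \<noteq> 0\<^sub>v n" "?A *\<^sub>v v = c \<cdot>\<^sub>v v"
    using A by (auto simp: eigenvector_def)
  let ?B = "?A - c \<cdot>\<^sub>m 1\<^sub>m n"
  have B: "?B \<in> carrier_mat n n" using A by auto
  have Bv: "?B *\<^sub>v v = 0\<^sub>v n"
  proof -
    have "?B *\<^sub>v v = ?A *\<^sub>v v - (c \<cdot>\<^sub>m 1\<^sub>m n) *\<^sub>v v"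
      using A v by (intro minus_mult_distrib_mat_vec) auto
    also have "(c \<cdot>\<^sub>m 1\<^sub>m n) *\<^sub>v v = c \<cdot>\<^sub>v v" using v by auto
    finally show ?thesis using v by auto
  qed
  have B0: "?B = 0\<^sub>m n n"
  proof (rule ccontr)
    assume nz: "?B \<noteq> 0\<^sub>m n n"
    have "\<rho> g * ?B = ?B * \<rho> g" if g: "g \<in> carrier G" for g
    proof -
      have "\<rho> g * ?B = \<rho> g * ?A - \<rho> g * (c \<cdot>\<^sub>m 1\<^sub>m n)"
        by (rule mult_minus_distrib_mat[OF rc[OF g] A]) simp
      also have "\<rho> g * (c \<cdot>\<^sub>m 1\<^sub>m n) = (c \<cdot>\<^sub>m 1\<^sub>m n) * \<rho> g"
        using rc[OF g] by (subst mult_smult_distrib[OF rc[OF g] one_carrier_mat],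
            subst mult_smult_assoc_mat[OF one_carrier_mat rc[OF g]]) simp
      also have "\<rho> g * ?A = ?A * \<rho> g"
        by (rule average_intertwines[OF \<open>group G\<close> hom(1) hom(1) hom(2) hom(2) g])
      also have "?A * \<rho> g - (c \<cdot>\<^sub>m 1\<^sub>m n) * \<rho> g = ?B * \<rho> g"
        by (rule minus_mult_distrib_mat[OF A _ rc[OF g], symmetric]) simp
      finally show ?thesis .
    qed
    from schur[OF r' r' B nz this] obtain C where C: "C \<in> carrier_mat n n" "C * ?B = 1\<^sub>m n"
      by blast
    have "v = C * ?B *\<^sub>v v" using C v by simp
    also have "\<dots> = C *\<^sub>v (?B *\<^sub>v v)" by (rule assoc_mult_mat_vec[OF C(1) B v(1)])
    also have "\<dots> = 0\<^sub>v n" using Bv C by auto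
    finally show False using v by simp
  qed
  have entry: "?A $$ (i, i) = c" if "i < n" for i
  proof -
    have "?B $$ (i, i) = 0" by (subst B0) (use that in simp)
    thus ?thesis using that A by simp
  qed
  have "of_nat n * c = (\<Sum>i<n. ?A $$ (i, i))" by (simp add: entry)
  also have "\<dots> = (\<Sum>i<n. \<Sum>g\<in>carrier G. \<rho> g $$ (i, 0) * \<rho> (inv g) $$ (0, i))"
    by (simp add: average_def)
  also have "\<dots> = (\<Sum>g\<in>carrier G. \<Sum>i<n. \<rho> (inv g) $$ (0, i) * \<rho> g $$ (i, 0))"
    by (subst sum.swap) (simp add: mult.commute)
  also have "\<dots> = (\<Sum>g\<in>carrier G. \<rho> (inv g \<otimes> g) $$ (0, 0))"
    using hom(2) by (intro sum.cong refl)
      (subst GL_hom(2)[OF hom(1)], auto simp del: index_mult_mat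
        intro!: index_mult_mat_sum[OF rc rc, symmetric])
  also have "\<dots> = of_nat (Coset.order G)"
    using hom(2) GL_hom(3)[OF hom(1) \<open>group G\<close>] by (simp add: Coset.order_def)
  finally show ?thesis using entry[OF hom(2)] hom(2) by (simp add: average_def)
qed

text \<open>
  The \<open>(0, 0)\<close> coefficients of pairwise non-isomorphic irreducible representations are orthogonal,
  so there are at most \<open>|G|\<close> classes. Given one more, padding the coefficient matrix by a zero
  column makes it square; it would have a right inverse but no left inverse. Every lower bound on \<open>T\<close>
  needs this finiteness, since a sum over an infinite set is \<open>0\<close>.
\<close>

lemma finite_irrep_classes:
  fixes G (structure)
  assumes "group G" "finite (carrier G)"
  shows "finite (irreps G // rep_iso G)"
proof (rule ccontr)
  interpret group G by fact
  define N where "N = Coset.order G"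
  have N: "N > 0" using assms order_gt_0_iff_finite by (simp add: N_def)
  assume "\<not> ?thesis"
  then obtain S where S: "finite S" "card S = Suc N" "S \<subseteq> irreps G // rep_iso G"
    using infinite_arbitrarily_large by blast
  obtain f where f: "bij_betw f {0..<Suc N} S" using ex_bij_betw_nat_finite S by metis
  obtain h where h: "bij_betw h {0..<N} (carrier G)"
    using ex_bij_betw_nat_finite[OF assms(2)] by (auto simp: N_def Coset.order_def)
  define x where "x i = (SOME y. y \<in> f i)" for i
  define n where "n i = fst (x i)" for i
  define \<rho> where "\<rho> i = snd (x i)" for i
  have fS: "f i \<in> irreps G // rep_iso G" if "i < Suc N" for i
    using f S(3) that by (auto simp: bij_betw_def)
  have xf: "x i \<in> f i" if "i < Suc N" for i
    unfolding x_def using in_quotient_imp_non_empty[OF equiv_rep_iso fS[OF that]]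
    by (meson ex_in_conv someI_ex)
  have irr: "(n i, \<rho> i) \<in> irreps G" if "i < Suc N" for i
    using xf[OF that] in_quotient_imp_subset[OF equiv_rep_iso fS[OF that]]
    by (auto simp: n_def \<rho>_def)
  have ni: "((n i, \<rho> i), (n j, \<rho> j)) \<notin> rep_iso G" if "i < Suc N" "j < Suc N" "i \<noteq> j" for i j
  proof
    assume "((n i, \<rho> i), (n j, \<rho> j)) \<in> rep_iso G"
    hence "f i = f j"
      using quotient_eq_iff[OF equiv_rep_iso fS fS xf xf] that by (auto simp: n_def \<rho>_def)
    with f that show False by (auto simp: bij_betw_def inj_on_def)
  qed
  define P where "P = mat (Suc N) (Suc N) (\<lambda>(i, k). if k < N then \<rho> i (h k) $$ (0, 0) else 0)"
  \<comment> \<open>The factor \<open>of_nat (n j) / of_nat N\<close> is what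
    \<open>matrix_coeff_norm\<close> requires for diagonal entries equal to 1.\<close>
  define Q where "Q = mat (Suc N) (Suc N)
    (\<lambda>(k, j). if k < N then of_nat (n j) / of_nat N * \<rho> j (inv (h k)) $$ (0, 0) else 0)"
  have P: "P \<in> carrier_mat (Suc N) (Suc N)" and Q: "Q \<in> carrier_mat (Suc N) (Suc N)"
    by (auto simp: P_def Q_def)
  have "P * Q = 1\<^sub>m (Suc N)"
  proof (rule eq_matI)
    fix i j assume "i < dim_row (1\<^sub>m (Suc N))" "j < dim_col (1\<^sub>m (Suc N))"
    hence ij: "i < Suc N" "j < Suc N" by auto
    have "(P * Q) $$ (i, j) = (\<Sum>k<N. \<rho> i (h k) $$ (0, 0) *
        (of_nat (n j) / of_nat N * \<rho> j (inv (h k)) $$ (0, 0)))"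
      unfolding index_mult_mat_sum[OF P Q ij] using ij by (simp add: P_def Q_def)
    also have "\<dots> = of_nat (n j) / of_nat N *
        (\<Sum>k<N. \<rho> i (h k) $$ (0, 0) * \<rho> j (inv (h k)) $$ (0, 0))"
      by (simp add: sum_distrib_left mult_ac)
    also have "(\<Sum>k<N. \<rho> i (h k) $$ (0, 0) * \<rho> j (inv (h k)) $$ (0, 0)) =
        (\<Sum>g\<in>carrier G. \<rho> i g $$ (0, 0) * \<rho> j (inv g) $$ (0, 0))"
      using h by (intro sum.reindex_bij_betw) (simp add: atLeast0LessThan)
    also have "of_nat (n j) / of_nat N * \<dots> = 1\<^sub>m (Suc N) $$ (i, j)"
      using matrix_coeff_norm[OF \<open>group G\<close> irr[OF ij(2)]] N ij
        matrix_coeff_orthogonal[OF \<open>group G\<close> irr[OF ij(1)] irr[OF ij(2)] ni[OF ij]]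
      by (cases "i = j") (auto simp: N_def)
    finally show "(P * Q) $$ (i, j) = 1\<^sub>m (Suc N) $$ (i, j)" .
  qed (use P Q in auto)
  hence "Q * P = 1\<^sub>m (Suc N)" by (rule mat_mult_left_right_inverse[OF P Q])
  hence "(Q * P) $$ (N, N) = 1" by simp
  moreover have "(Q * P) $$ (N, N) = 0"
    by (subst index_mult_mat_sum[OF Q P]) (auto simp: P_def Q_def)
  ultimately show False by simp
qed

text \<open>Pairwise non-isomorphic representations occupy distinct classes, and the remaining
  classes only add nonnegative degrees. Every later bound on \<open>T\<close> passes through this,
  so no classification of irreducible representations is required.\<close>

lemma T_ge_sum_degrees:
  assumes "group G" "finite (carrier G)" "finite X" "X \<subseteq> irreps G"
    and "\<And>x y. x \<in> X \<Longrightarrow> y \<in> X \<Longrightarrow> (x, y) \<in> rep_iso G \<Longrightarrow> x = y"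
  shows "T G \<ge> (\<Sum>x\<in>X. fst x)"
proof -
  let ?c = "\<lambda>x. rep_iso G `` {x}"
  have inj: "inj_on ?c X"
    using assms(4,5) eq_equiv_class[OF _ equiv_rep_iso] by (meson inj_onI subsetD)
  have "(\<Sum>x\<in>X. fst x) = (\<Sum>x\<in>X. the_elem (fst ` ?c x))"
    using assms(4) by (intro sum.cong refl) (auto simp: degree_of_class)
  also have "\<dots> = (\<Sum>C\<in>?c ` X. the_elem (fst ` C))"
    by (simp add: sum.reindex[OF inj] o_def)
  also have "\<dots> \<le> T G" unfolding T_def
    using assms(4) by (intro sum_mono2 finite_irrep_classes assms(1,2)) (auto intro: quotientI)
  finally show ?thesis .
qed

section \<open>Linear characters of finite abelian groups\<close>

text \<open>Extensionality discards values outside \<open>H\<close>, so that counting these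
  functions counts characters. The subgroup is a parameter beside \<open>G\<close> so that
  characters of growing subgroups share one multiplication.\<close>

definition linear_chars :: "('a, 'b) monoid_scheme \<Rightarrow> 'a set \<Rightarrow> ('a \<Rightarrow> complex) set" where
  "linear_chars G H = {\<chi> \<in> extensional H.
     \<forall>x\<in>H. \<chi> x \<noteq> 0 \<and> (\<forall>y\<in>H. \<chi> (x \<otimes>\<^bsub>G\<^esub> y) = \<chi> x * \<chi> y)}"

context group
begin

lemma linear_char_one:
  assumes "subgroup H G" "\<chi> \<in> linear_chars G H"
  shows "\<chi> \<one> = 1"
proof -
  have "\<one> \<in> H" using assms(1) by (rule subgroup.one_closed)
  hence "\<chi> (\<one> \<otimes> \<one>) = \<chi> \<one> * \<chi> \<one>" "\<chi> \<one> \<noteq> 0"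
    using assms(2) unfolding linear_chars_def by blast+
  thus ?thesis by simp
qed

lemma subgroup_nat_pow_closed:
  "subgroup H G \<Longrightarrow> x \<in> H \<Longrightarrow> x [^] (n::nat) \<in> H"
  by (induction n) (auto simp: subgroup.one_closed subgroup.m_closed)

lemma linear_char_pow:
  assumes "subgroup H G" "\<chi> \<in> linear_chars G H" "x \<in> H"
  shows "\<chi> (x [^] (n::nat)) = \<chi> x ^ n"
proof (induction n)
  case 0
  show ?case using linear_char_one[OF assms(1,2)] by simp
next
  case (Suc n)
  have "x [^] n \<in> H" using subgroup_nat_pow_closed[OF assms(1,3)] .
  thus ?case using Suc assms by (simp add: linear_chars_def)
qed

lemma linear_char_inv:
  assumes "subgroup H G" "\<chi> \<in> linear_chars G H" "x \<in> H"
  shows "\<chi> (inv x) = inverse (\<chi> x)"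
proof -
  have x: "x \<in> carrier G" "inv x \<in> H"
    using assms subgroup.mem_carrier subgroup.m_inv_closed by metis+
  have "\<forall>y\<in>H. \<chi> (inv x \<otimes> y) = \<chi> (inv x) * \<chi> y"
    using assms(2) x(2) unfolding linear_chars_def by blast
  hence "\<chi> (inv x) * \<chi> x = \<chi> (inv x \<otimes> x)" using assms(3) by metis
  also have "\<dots> = 1" using x linear_char_one[OF assms(1,2)] by simp
  finally show ?thesis by (metis inverse_unique mult.commute)
qed

text \<open>Closure under inverses comes from finiteness: \<open>inv a\<close> is the power of
  \<open>a\<close> with exponent \<open>ord a - 1\<close>.\<close>

lemma finite_subgroupI:
  assumes "finite (carrier G)" "H \<subseteq> carrier G" "\<one> \<in> H"
    and "\<And>x y. x \<in> H \<Longrightarrow> y \<in> H \<Longrightarrow> x \<otimes> y \<in> H"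
  shows "subgroup H G"
proof (rule subgroupI)
  fix a assume a: "a \<in> H"
  hence ac: "a \<in> carrier G" using assms(2) by blast
  have pow: "a [^] (n::nat) \<in> H" for n
    by (induction n) (use assms(3,4) a in auto)
  have "ord a \<ge> 1" using ord_ge_1[OF assms(1) ac] .
  then obtain m where m: "ord a = Suc m" by (cases "ord a") auto
  hence "a [^] m \<otimes> a = \<one>" using pow_ord_eq_1[OF ac] by simp
  hence "inv a = a [^] m" using ac by (intro inv_equality) auto
  thus "inv a \<in> H" using pow by simp
qed (use assms in auto)

end

text \<open>
  If \<open>k\<close> is the least positive exponent with \<open>y\<^sup>k \<in> H\<close>, a character \<open>\<chi>\<close> of \<open>H\<close> extends to the subgroup
  generated by \<open>H\<close> and \<open>y\<close> by sending \<open>y\<close> to any of the \<open>k\<close> roots of \<open>z\<^sup>k = \<chi> (y\<^sup>k)\<close>.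
\<close>

lemma (in comm_group) extend_linear_chars:
  assumes fin: "finite (carrier G)" and H: "subgroup H G"
    and F: "finite F" "F \<subseteq> linear_chars G H" "card F = card H"
    and y: "y \<in> carrier G" "y \<notin> H"
  obtains K F' where "subgroup K G" "H \<subset> K" "finite F'" "F' \<subseteq> linear_chars G K" "card F' = card K"
proof -
  note Hc = subgroup.mem_carrier[OF H] and Hm = subgroup.m_closed[OF H]
    and Hi = subgroup.m_inv_closed[OF H] and H1 = subgroup.one_closed[OF H]
  have ex: "0 < ord y \<and> y [^] ord y \<in> H"
    using ord_ge_1[OF fin y(1)] y H1 by simp
  define k where "k = (LEAST k::nat. 0 < k \<and> y [^] k \<in> H)"
  have k: "0 < k" "y [^] k \<in> H" using LeastI[of "\<lambda>k::nat. 0 < k \<and> y [^] k \<in> H", OF ex]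
    by (auto simp: k_def)
  have k_least: "y [^] m \<notin> H" if "0 < m" "m < k" for m
    using not_less_Least[of m "\<lambda>k::nat. 0 < k \<and> y [^] k \<in> H"] that by (auto simp: k_def)
  \<comment> \<open>Division by \<open>k\<close>: the remainder is again an exponent landing in
    \<open>H\<close>, so minimality of \<open>k\<close> forces it to be 0.\<close>
  have k_dvd: "k dvd n" if "y [^] n \<in> H" for n :: nat
  proof -
    have "y [^] n = (y [^] k) [^] (n div k) \<otimes> y [^] (n mod k)"
      using y by (simp add: nat_pow_pow nat_pow_mult)
    moreover have q: "(y [^] k) [^] (n div k) \<in> H"
      by (rule subgroup_nat_pow_closed[OF H k(2)])
    ultimately have "y [^] (n mod k) = inv ((y [^] k) [^] (n div k)) \<otimes> y [^] n"
      using y Hc[OF q] by (simp add: m_assoc[symmetric])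
    hence "y [^] (n mod k) \<in> H" using that q Hm Hi by simp
    with k_least[of "n mod k"] k have "n mod k = 0" by auto
    thus ?thesis by auto
  qed
  have pow_add: "y [^] (i + j) = y [^] i \<otimes> y [^] j" for i j :: nat
    using y by (simp add: nat_pow_mult)
  define K where "K = {y [^] i \<otimes> h |i h. h \<in> H \<and> i \<in> (UNIV :: nat set)}"
  have K: "subgroup K G"
  proof (rule finite_subgroupI[OF fin])
    show "K \<subseteq> carrier G" using y Hc by (auto simp: K_def)
    show "\<one> \<in> K" unfolding K_def using H1 by (auto intro!: exI[of _ "0::nat"] exI[of _ \<one>])
    fix a b assume "a \<in> K" "b \<in> K"
    then obtain i h j h' where ab: "a = y [^] (i::nat) \<otimes> h" "h \<in> H" "b = y [^] (j::nat) \<otimes> h'" "h' \<in> H"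
      by (auto simp: K_def)
    hence "a \<otimes> b = y [^] (i + j) \<otimes> (h \<otimes> h')"
      using pow_add[of i j] y Hc by (simp add: m_ac)
    thus "a \<otimes> b \<in> K" using ab Hm by (auto simp: K_def)
  qed
  have HK: "h \<in> K" if "h \<in> H" for h
    unfolding K_def using that Hc by (auto intro!: exI[of _ "0::nat"] exI[of _ h])
  have yK: "y \<in> K"
    unfolding K_def using y H1 by (auto intro!: exI[of _ "1::nat"] exI[of _ \<one>])
  \<comment> \<open>Exponents in two expressions of one element differ by a multiple of
    \<open>k\<close>. This gives uniqueness for exponents below \<open>k\<close> and later the
    well-definedness of the extended character.\<close>
  have quot: "k dvd j - i \<and> y [^] (j - i) \<otimes> h' = h"
    if "y [^] i \<otimes> h = y [^] j \<otimes> h'" "h \<in> H" "h' \<in> H" "i \<le> j" for i j :: nat and h h'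
  proof -
    have "y [^] j = y [^] i \<otimes> y [^] (j - i)" using y that(4) by (simp add: nat_pow_mult)
    with that(1) have "y [^] i \<otimes> h = y [^] i \<otimes> (y [^] (j - i) \<otimes> h')"
      using y Hc that(2,3) by (simp add: m_assoc)
    hence eq: "h = y [^] (j - i) \<otimes> h'" using y Hc that(2,3) by simp
    hence "y [^] (j - i) = h \<otimes> inv h'" using y Hc that(2,3) by (simp add: m_assoc)
    hence "y [^] (j - i) \<in> H" using that(2,3) Hm Hi by simp
    with k_dvd eq show ?thesis by simp
  qed
  have card_K: "card K = k * card H"
  proof -
    have "bij_betw (\<lambda>(i, h). y [^] i \<otimes> h) ({..<k} \<times> H) K"
      unfolding bij_betw_def
    proof
      show "inj_on (\<lambda>(i, h). y [^] i \<otimes> h) ({..<k} \<times> H)"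
      proof -
        have **: "i = j \<and> h = h'" if "y [^] i \<otimes> h = y [^] j \<otimes> h'" "h \<in> H" "h' \<in> H" "i \<le> j" "j < k"
          for i j h h'
        proof -
          have "k dvd j - i" using quot that by blast
          moreover have "j - i < k" using that by simp
          ultimately have "j - i = 0" by (metis dvd_imp_le not_less zero_less_iff_neq_zero)
          thus ?thesis using that quot[OF that(1-4)] Hc by auto
        qed
        have *: "i = j \<and> h = h'" if "y [^] i \<otimes> h = y [^] j \<otimes> h'" "h \<in> H" "h' \<in> H" "i < k" "j < k"
          for i j h h'
          using **[OF that(1-3) _ that(5)] **[OF that(1)[symmetric] that(3,2) _ that(4)]
          by (cases "i \<le> j") simp_all
        show ?thesis by (rule inj_onI) (use * in auto)
      qed
      have "y [^] i \<otimes> h \<in> (\<lambda>(i, h). y [^] i \<otimes> h) ` ({..<k} \<times> H)" if h: "h \<in> H" for i :: nat and h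
      proof (rule image_eqI)
        have q: "(y [^] k) [^] (i div k) \<in> H" by (rule subgroup_nat_pow_closed[OF H k(2)])
        show "(i mod k, (y [^] k) [^] (i div k) \<otimes> h) \<in> {..<k} \<times> H" using k Hm[OF q h] by simp
        have "y [^] i = y [^] (i mod k) \<otimes> (y [^] k) [^] (i div k)"
          using y by (simp add: nat_pow_pow nat_pow_mult)
        thus "y [^] i \<otimes> h = (case (i mod k, (y [^] k) [^] (i div k) \<otimes> h) of (i, h) \<Rightarrow> y [^] i \<otimes> h)"
          using y Hc[OF q] Hc[OF h] by (simp add: m_assoc)
      qed
      thus "(\<lambda>(i, h). y [^] i \<otimes> h) ` ({..<k} \<times> H) = K" by (auto simp: K_def)
    qed
    from bij_betw_same_card[OF this] show ?thesis by (simp add: card_cartesian_product)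
  qed
  \<comment> \<open>\<open>SOME\<close> picks an arbitrary expression
    \<open>y [^] i \<otimes> h\<close> of the element; the condition
    \<open>z ^ k = \<chi> (y [^] k)\<close> makes the value independent of the choice.\<close>
  define ext where "ext \<chi> z = (\<lambda>x\<in>K. case (SOME (i, h). h \<in> H \<and> x = y [^] i \<otimes> h) of (i, h) \<Rightarrow> z ^ i * \<chi> h)"
    for \<chi> :: "'a \<Rightarrow> complex" and z :: complex
  have ext: "ext \<chi> z (y [^] i \<otimes> h) = z ^ i * \<chi> h"
    if \<chi>: "\<chi> \<in> linear_chars G H" and z: "z ^ k = \<chi> (y [^] k)" and h: "h \<in> H" for \<chi> z h and i :: nat
  proof -
    have wd: "z ^ i * \<chi> h = z ^ j * \<chi> h'"
      if "y [^] i \<otimes> h = y [^] j \<otimes> h'" "h \<in> H" "h' \<in> H" "i \<le> j" for i j :: nat and h h'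
    proof -
      from quot[OF that] have h: "h = y [^] (j - i) \<otimes> h'" and "k dvd j - i" by simp_all
      then obtain q where q: "j - i = k * q" by (elim dvdE)
      have yq: "y [^] (j - i) = (y [^] k) [^] q" using y q by (simp add: nat_pow_pow)
      have "\<chi> h = \<chi> ((y [^] k) [^] q) * \<chi> h'"
        using \<chi> that(3) subgroup_nat_pow_closed[OF H k(2)] unfolding h yq
        by (simp add: linear_chars_def)
      also have "\<chi> ((y [^] k) [^] q) = z ^ (j - i)"
        using linear_char_pow[OF H \<chi> k(2)] z q by (simp add: power_mult)
      finally have "z ^ i * \<chi> h = z ^ (i + (j - i)) * \<chi> h'" by (simp add: power_add)
      thus ?thesis using that(4) by simp
    qed
    let ?s = "SOME (i', h'). h' \<in> H \<and> y [^] i \<otimes> h = y [^] (i'::nat) \<otimes> h'"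
    have "case ?s of (i', h') \<Rightarrow> h' \<in> H \<and> y [^] i \<otimes> h = y [^] i' \<otimes> h'"
      by (rule someI[of _ "(i, h)"]) (use h in simp)
    then obtain i' h' where s: "?s = (i', h')" "h' \<in> H" "y [^] i \<otimes> h = y [^] i' \<otimes> h'"
      by (auto split: prod.splits)
    have "z ^ i' * \<chi> h' = z ^ i * \<chi> h"
      using wd[OF s(3) h s(2)] wd[OF s(3)[symmetric] s(2) h] by (cases "i \<le> i'") simp_all
    moreover have "y [^] i \<otimes> h \<in> K" using h by (auto simp: K_def)
    ultimately show ?thesis unfolding ext_def using s(1) by simp
  qed
  \<comment> \<open>There are \<open>card H\<close> characters with \<open>k\<close> roots each, so
    exactly \<open>card K\<close> pairs.\<close>
  define D where "D = (SIGMA \<chi>:F. {z. z ^ k = \<chi> (y [^] k)})"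
  have D: "\<chi> \<in> linear_chars G H" "z ^ k = \<chi> (y [^] k)" if "(\<chi>, z) \<in> D" for \<chi> z
    using that F by (auto simp: D_def)
  have roots: "finite {z. z ^ k = \<chi> (y [^] k)}" "card {z. z ^ k = \<chi> (y [^] k)} = k" if "\<chi> \<in> F" for \<chi>
  proof -
    have "\<chi> (y [^] k) \<noteq> 0" using that F k by (auto simp: linear_chars_def)
    thus "card {z. z ^ k = \<chi> (y [^] k)} = k" using card_nth_roots k by blast
    thus "finite {z. z ^ k = \<chi> (y [^] k)}" using k card_gt_0_iff by metis
  qed
  have "card D = (\<Sum>\<chi>\<in>F. k)" unfolding D_def using F roots by (subst card_SigmaI) auto
  hence card_D: "card D = card K" using card_K F by simp
  have fin_D: "finite D" unfolding D_def using F roots by auto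
  have inj: "inj_on (\<lambda>(\<chi>, z). ext \<chi> z) D"
  proof (rule inj_onI, clarify)
    fix \<chi> z \<psi> w assume a: "(\<chi>, z) \<in> D" "(\<psi>, w) \<in> D" and eq: "ext \<chi> z = ext \<psi> w"
    have "z ^ i * \<chi> h = w ^ i * \<psi> h" if "h \<in> H" for i h
      by (simp only: eq ext[OF D[OF a(1)] that, symmetric] ext[OF D[OF a(2)] that, symmetric])
    \<comment> \<open>The exponent 0 recovers \<open>\<chi>\<close> on \<open>H\<close>, and the
      value at \<open>y\<close> itself recovers \<open>z\<close>.\<close>
    note this[where i = 0] and eq1 = this[OF H1, of 1]
    hence "\<chi> h = \<psi> h" if "h \<in> H" for h using that by simp
    moreover have "\<chi> \<in> extensional H" "\<psi> \<in> extensional H"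
      using D[OF a(1)] D[OF a(2)] by (auto simp: linear_chars_def)
    ultimately have "\<chi> = \<psi>" by (rule extensionalityI[rotated 2])
    moreover have "z = w"
      using eq1 linear_char_one[OF H D(1)[OF a(1)]] linear_char_one[OF H D(1)[OF a(2)]] by simp
    ultimately show "\<chi> = \<psi> \<and> z = w" by simp
  qed
  have "ext \<chi> z \<in> linear_chars G K" if "(\<chi>, z) \<in> D" for \<chi> z
  proof -
    note d = D[OF that]
    have z: "z \<noteq> 0" using d k by (auto simp: linear_chars_def zero_power)
    have "ext \<chi> z (y [^] i \<otimes> h) \<noteq> 0" if "h \<in> H" for i :: nat and h
    proof -
      have "\<chi> h \<noteq> 0" using d(1) that by (simp add: linear_chars_def)
      thus ?thesis using z by (simp only: ext[OF d that] mult_eq_0_iff power_eq_0_iff) simp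
    qed
    moreover have "ext \<chi> z ((y [^] i \<otimes> h) \<otimes> (y [^] j \<otimes> h')) =
        ext \<chi> z (y [^] i \<otimes> h) * ext \<chi> z (y [^] j \<otimes> h')"
      if "h \<in> H" "h' \<in> H" for i j :: nat and h h'
    proof -
      have "(y [^] i \<otimes> h) \<otimes> (y [^] j \<otimes> h') = y [^] (i + j) \<otimes> (h \<otimes> h')"
        using pow_add[of i j] y Hc that by (simp add: m_ac)
      hence "ext \<chi> z ((y [^] i \<otimes> h) \<otimes> (y [^] j \<otimes> h')) = z ^ (i + j) * \<chi> (h \<otimes> h')"
        using ext[OF d Hm[OF that], of "i + j"] by simp
      also have "\<chi> (h \<otimes> h') = \<chi> h * \<chi> h'"
        using d(1) that by (simp add: linear_chars_def)
      also have "z ^ (i + j) * (\<chi> h * \<chi> h') = (z ^ i * \<chi> h) * (z ^ j * \<chi> h')"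
        by (simp add: power_add mult_ac)
      also have "\<dots> = ext \<chi> z (y [^] i \<otimes> h) * ext \<chi> z (y [^] j \<otimes> h')"
        by (simp only: ext[OF d that(1)] ext[OF d that(2)])
      finally show ?thesis .
    qed
    moreover have "ext \<chi> z \<in> extensional K" by (simp add: ext_def)
    ultimately show ?thesis
      unfolding linear_chars_def by (auto simp: K_def)
  qed
  hence "(\<lambda>(\<chi>, z). ext \<chi> z) ` D \<subseteq> linear_chars G K" by auto
  moreover have "card ((\<lambda>(\<chi>, z). ext \<chi> z) ` D) = card K"
    using card_image[OF inj] card_D by simp
  moreover have "H \<subset> K" using HK yK y by auto
  ultimately show thesis
    by (intro that[OF K, of "(\<lambda>(\<chi>, z). ext \<chi> z) ` D"] finite_imageI fin_D)
qed

text \<open>Maximality replaces the explicit chain: a maximal subgroup having as many characters as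
  elements must be \<open>G\<close>, since \<open>extend_linear_chars\<close> would enlarge any
  other. The trivial subgroup starts the process.\<close>

lemma (in comm_group) linear_chars_abundant:
  assumes fin: "finite (carrier G)"
  obtains F where "finite F" "F \<subseteq> linear_chars G (carrier G)" "card F = Coset.order G"
proof -
  define \<H> where "\<H> = {H. subgroup H G \<and>
    (\<exists>F. finite F \<and> F \<subseteq> linear_chars G H \<and> card F = card H)}"
  have "\<H> \<subseteq> Pow (carrier G)" by (auto simp: \<H>_def dest: subgroup.mem_carrier)
  hence "finite \<H>" using fin by (meson finite_Pow_iff finite_subset)
  moreover have "{\<one>} \<in> \<H>"
    unfolding \<H>_def using triv_subgroup
    by (auto intro!: exI[of _ "{\<lambda>x\<in>{\<one>}. 1}"] simp: linear_chars_def)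
  ultimately obtain H where H: "H \<in> \<H>" and max: "\<And>K. K \<in> \<H> \<Longrightarrow> H \<subseteq> K \<Longrightarrow> H = K"
    using finite_has_maximal[of \<H>] by blast
  then obtain F where F: "subgroup H G" "finite F" "F \<subseteq> linear_chars G H" "card F = card H"
    by (auto simp: \<H>_def)
  have "H = carrier G"
  proof (rule ccontr)
    assume "H \<noteq> carrier G"
    then obtain y where "y \<in> carrier G" "y \<notin> H" using F(1) subgroup.subset by blast
    from extend_linear_chars[OF fin F this] obtain K F' where
      "subgroup K G" "H \<subset> K" "finite F'" "F' \<subseteq> linear_chars G K" "card F' = card K" by blast
    with max[of K] show False by (auto simp: \<H>_def)
  qed
  with F that show thesis by (simp add: Coset.order_def)
qed

section \<open>Linear characters as representations of degree one\<close>

lemma linear_char_irrep: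
  fixes G (structure)
  assumes "\<chi> \<in> linear_chars G (carrier G)"
  shows "(1, \<lambda>g. mat 1 1 (\<lambda>_. \<chi> g)) \<in> irreps G"
proof -
  let ?r = "\<lambda>g. mat 1 1 (\<lambda>_. \<chi> g)"
  have "?r g \<in> carrier (GL 1)" if "g \<in> carrier G" for g
    unfolding GL_carrier using that assms
    by (auto intro!: bexI[of _ "mat 1 1 (\<lambda>_. inverse (\<chi> g))"] eq_matI
        simp: linear_chars_def scalar_prod_def)
  moreover have "?r (g \<otimes> h) = ?r g * ?r h" if "g \<in> carrier G" "h \<in> carrier G" for g h
    using that assms by (auto intro!: eq_matI simp: linear_chars_def scalar_prod_def)
  ultimately have "?r \<in> hom G (GL 1)" by (auto simp: hom_def GL_simps(2))
  moreover have "W = {0\<^sub>v 1} \<or> W = carrier_vec 1" if "invariant_subspace G 1 ?r W" for W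
  proof (cases "W = {0\<^sub>v 1}")
    case False
    note W = invariant_subspaceD[OF that]
    obtain w where w: "w \<in> W" "w \<noteq> 0\<^sub>v 1" using False W(2) by blast
    have wc: "w \<in> carrier_vec 1" using w W(1) by blast
    have w0: "w $ 0 \<noteq> 0" using w(2) wc by (auto simp: vec_eq_iff)
    have "v \<in> W" if v: "v \<in> carrier_vec 1" for v
    proof -
      have "(v $ 0 / w $ 0) \<cdot>\<^sub>v w = v" using v wc w0 by (intro eq_vecI) auto
      thus ?thesis using W(4)[OF w(1)] by metis
    qed
    thus ?thesis using W(1) by blast
  qed simp
  ultimately show ?thesis by (simp add: irreps_def irreducible_rep_def)
qed

text \<open>An invertible intertwiner of degree one is a nonzero number and cancels.\<close>

lemma linear_char_rep_iso:
  assumes "\<chi> \<in> linear_chars G (carrier G)" "\<psi> \<in> linear_chars G (carrier G)"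
    and "((1, \<lambda>g. mat 1 1 (\<lambda>_. \<chi> g)), (1, \<lambda>g. mat 1 1 (\<lambda>_. \<psi> g))) \<in> rep_iso G"
  shows "\<chi> = \<psi>"
proof (rule extensionalityI[of _ "carrier G"])
  fix g assume g: "g \<in> carrier G"
  from assms(3) obtain P where P: "P \<in> carrier (GL 1)"
    "P * mat 1 1 (\<lambda>_. \<chi> g) = mat 1 1 (\<lambda>_. \<psi> g) * P"
    using g unfolding rep_iso_def by blast
  then obtain Q where Q: "P \<in> carrier_mat 1 1" "Q \<in> carrier_mat 1 1" "P * Q = 1\<^sub>m 1"
    by (auto simp: GL_carrier)
  have "(P * Q) $$ (0, 0) = 1" using Q by simp
  hence "P $$ (0, 0) \<noteq> 0" using Q(1,2) by (auto simp: scalar_prod_def)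
  moreover have "P $$ (0, 0) * \<chi> g = \<psi> g * P $$ (0, 0)"
    using arg_cong[OF P(2), of "\<lambda>M. M $$ (0, 0)"] Q(1) by (simp add: scalar_prod_def)
  ultimately show "\<chi> g = \<psi> g" by simp
qed (use assms in \<open>auto simp: linear_chars_def\<close>)

lemma inj_linear_char_rep:
  "inj (\<lambda>\<chi>. (1::nat, \<lambda>g. mat 1 1 (\<lambda>_. \<chi> g :: complex)))"
proof (rule injI)
  fix \<chi> \<psi> :: "'a \<Rightarrow> complex"
  assume "(1::nat, \<lambda>g. mat 1 1 (\<lambda>_. \<chi> g)) = (1, \<lambda>g. mat 1 1 (\<lambda>_. \<psi> g))"
  hence "mat 1 1 (\<lambda>_. \<chi> g) $$ (0, 0) = mat 1 1 (\<lambda>_. \<psi> g) $$ (0, 0)" for g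
    by (metis prod.inject)
  thus "\<chi> = \<psi>" by auto
qed

lemma (in comm_group) T_ge_order:
  assumes "finite (carrier G)"
  shows "T G \<ge> Coset.order G"
proof -
  obtain F where F: "finite F" "F \<subseteq> linear_chars G (carrier G)" "card F = Coset.order G"
    using linear_chars_abundant[OF assms] .
  let ?r = "\<lambda>\<chi>. (1::nat, \<lambda>g::'a. mat 1 1 (\<lambda>_. \<chi> g :: complex))"
  have inj: "inj_on ?r F" using inj_linear_char_rep by (rule inj_on_subset) simp
  have "(\<Sum>x\<in>?r ` F. fst x) \<le> T G"
  proof (rule T_ge_sum_degrees)
    show "x = y" if "x \<in> ?r ` F" "y \<in> ?r ` F" "(x, y) \<in> rep_iso G" for x y
      using that F(2) linear_char_rep_iso[of _ G] by auto
  qed (use assms F linear_char_irrep[of _ G] in \<open>auto simp: group_axioms\<close>)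
  moreover have "(\<Sum>x\<in>?r ` F. fst x) = card F"
    by (subst sum.reindex[OF inj]) (simp add: o_def)
  ultimately show ?thesis using F by simp
qed

section \<open>Groups of order $p$, $p^2$ and $2p$\<close>

context group
begin

lemma inv_cancel_left:
  assumes "x \<in> carrier G" "y \<in> carrier G"
  shows "inv x \<otimes> (x \<otimes> y) = y" "x \<otimes> (inv x \<otimes> y) = y"
  using assms by (simp_all add: m_assoc[symmetric])

text \<open>Lagrange inside \<open>C\<close>: the order of \<open>x\<close> divides a prime and is
  not 1.\<close>

lemma ord_prime_subgroup:
  assumes "finite (carrier G)" and C: "subgroup C G" and p: "prime (card C)"
    and x: "x \<in> C" "x \<noteq> \<one>"
  shows "ord x = card C" "generate G {x} = C"
proof -
  have xc: "x \<in> carrier G" using C x subgroup.mem_carrier by metis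
  have sub: "generate G {x} \<subseteq> C" using generate_subgroup_incl[OF _ C] x by simp
  have gen: "subgroup (generate G {x}) G" using generate_is_subgroup xc by simp
  interpret CG: group "G\<lparr>carrier := C\<rparr>" using subgroup.subgroup_is_group[OF C group_axioms] .
  have finC: "finite C" using assms(1) C subgroup.subset finite_subset by metis
  have "subgroup (generate G {x}) (G\<lparr>carrier := C\<rparr>)"
    using subgroup_incl[OF gen C sub] .
  from CG.lagrange[OF this] have "card (generate G {x}) dvd Coset.order (G\<lparr>carrier := C\<rparr>)"
    by (metis dvd_triv_right)
  hence "card (generate G {x}) dvd card C" by (simp add: Coset.order_def)
  hence "ord x dvd card C" using generate_pow_card[OF xc] by simp
  moreover have "ord x \<noteq> 1" using ord_eq_1[OF xc] x by simp
  ultimately show o: "ord x = card C" using p by (metis prime_nat_iff)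
  thus "generate G {x} = C"
    using generate_pow_card[OF xc] sub finC by (intro card_subset_eq) auto
qed

lemma prime_subgroup_powers:
  assumes "finite (carrier G)" "subgroup C G" "prime (card C)" "x \<in> C" "x \<noteq> \<one>" "y \<in> C"
  obtains i :: nat where "y = x [^] i"
proof -
  have "x \<in> carrier G" using assms subgroup.mem_carrier by metis
  from generate_pow_on_finite_carrier[OF assms(1) this] ord_prime_subgroup(2)[OF assms(1-5)] assms(6) that
  show thesis by blast
qed

lemma comm_group_if_powers:
  assumes "g \<in> carrier G" "\<And>x. x \<in> carrier G \<Longrightarrow> \<exists>i::nat. x = g [^] i"
  shows "comm_group G"
proof (rule group_comm_groupI)
  fix x y assume "x \<in> carrier G" "y \<in> carrier G"
  then obtain i j :: nat where "x = g [^] i" "y = g [^] j" using assms(2) by blast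
  thus "x \<otimes> y = y \<otimes> x" using assms(1) by (simp add: nat_pow_mult add.commute)
qed

lemma comm_group_prime_order:
  assumes "finite (carrier G)" "prime (Coset.order G)"
  shows "comm_group G"
proof -
  have "card (carrier G) > 1" using assms(2) prime_gt_1_nat by (auto simp: Coset.order_def)
  hence "\<not> carrier G \<subseteq> {\<one>}" using card_mono[of "{\<one>}" "carrier G"] by auto
  then obtain g where g: "g \<in> carrier G" "g \<noteq> \<one>" by blast
  show ?thesis
  proof (rule comm_group_if_powers[OF g(1)])
    fix x assume "x \<in> carrier G"
    thus "\<exists>i::nat. x = g [^] i"
      using prime_subgroup_powers[OF assms(1) subgroup_self _ g, of x] assms(2)
      by (auto simp: Coset.order_def)
  qed
qed

text \<open>\<open>C\<close> and its translate by \<open>inv x\<close> are disjoint and each make up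
  half of \<open>G\<close>, so \<open>y = inv x \<otimes> c\<close> for some \<open>c\<close> in
  \<open>C\<close>.\<close>

lemma index_two_mult_mem:
  assumes fin: "finite (carrier G)" and C: "subgroup C G" and order: "Coset.order G = 2 * card C"
    and x: "x \<in> carrier G" "x \<notin> C" and y: "y \<in> carrier G" "y \<notin> C"
  shows "x \<otimes> y \<in> C"
proof -
  let ?D = "(\<lambda>c. inv x \<otimes> c) ` C"
  note Cc = subgroup.mem_carrier[OF C]
  have sub: "C \<subseteq> carrier G" by (rule subgroup.subset[OF C])
  have finC: "finite C" using fin sub finite_subset by blast
  have "inj_on (\<lambda>c. inv x \<otimes> c) C" using x Cc by (intro inj_onI) simp
  hence cD: "card ?D = card C" by (rule card_image)
  have "C \<inter> ?D = {}"
  proof (rule equals0I, clarify)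
    fix c assume c: "c \<in> C" "inv x \<otimes> c \<in> C"
    have "c \<otimes> inv (inv x \<otimes> c) \<in> C"
      using c subgroup.m_closed[OF C] subgroup.m_inv_closed[OF C] by blast
    moreover have "c \<otimes> inv (inv x \<otimes> c) = x"
      using c Cc x by (simp add: inv_mult_group m_assoc[symmetric])
    ultimately show False using x by simp
  qed
  hence "card (C \<union> ?D) = card (carrier G)"
    using finC order cD by (simp add: card_Un_disjoint Coset.order_def)
  moreover have "C \<union> ?D \<subseteq> carrier G" using sub x by auto
  ultimately have "C \<union> ?D = carrier G" using fin by (intro card_subset_eq)
  then obtain c where "c \<in> C" "y = inv x \<otimes> c" using y by blast
  thus ?thesis using x Cc by (simp add: m_assoc[symmetric])
qed

text \<open>
  If a conjugate \<open>d\<close> of \<open>c\<close> by \<open>g\<close> were outside \<open>C\<close>, the products of powers of \<open>d\<close> with elements of \<open>C\<close>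
  would exhaust the group, and writing \<open>g\<close> itself as such a product puts \<open>g\<close> in \<open>C\<close>.
\<close>

lemma normal_prime_subgroup_of_prime_square:
  assumes fin: "finite (carrier G)" and p: "prime p" and order: "Coset.order G = p ^ 2"
    and C: "subgroup C G" "card C = p" and g: "g \<in> carrier G" and c: "c \<in> C"
  shows "g \<otimes> c \<otimes> inv g \<in> C"
proof (rule ccontr)
  note Cc = subgroup.mem_carrier[OF C(1)] and Cm = subgroup.m_closed[OF C(1)]
    and Ci = subgroup.m_inv_closed[OF C(1)]
  define d where "d = g \<otimes> c \<otimes> inv g"
  assume "g \<otimes> c \<otimes> inv g \<notin> C"
  hence dC: "d \<notin> C" by (simp add: d_def)
  have cc: "c \<in> carrier G" and dc: "d \<in> carrier G" using c Cc g by (auto simp: d_def)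
  have d_pow: "d [^] n = g \<otimes> c [^] n \<otimes> inv g" for n :: nat
  proof (induction n)
    case (Suc n)
    thus ?case using g cc by (simp add: d_def m_assoc inv_cancel_left)
  qed (use g in simp)
  have c1: "c \<noteq> \<one>" using dC g subgroup.one_closed[OF C(1)] by (auto simp: d_def)
  have "ord c = p" using ord_prime_subgroup(1)[OF fin C(1) _ c c1] C p by simp
  hence dp: "d [^] p = \<one>" using d_pow[of p] cc g pow_ord_eq_1[OF cc] by simp
  have pow_notin: "d [^] m \<notin> C" if "0 < m" "m < p" for m
  proof
    assume m: "d [^] m \<in> C"
    \<comment> \<open>As \<open>m\<close> is invertible modulo \<open>p\<close>, the element
      \<open>d\<close> is a power of \<open>d [^] m\<close> and would lie in
      \<open>C\<close>.\<close>
    have "coprime m p" using that p by (metis coprime_commute dvd_imp_le not_less prime_imp_coprime)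
    hence "\<exists>u v. m * u = p * v + 1" using bezout_nat[of m p] that by auto
    then obtain u v where uv: "m * u = p * v + 1" by blast
    have "d [^] (m * u) = d [^] (p * v) \<otimes> d" unfolding uv using dc by simp
    also have "d [^] (p * v) = \<one>" using dp dc by (simp add: nat_pow_pow[symmetric])
    also have "d [^] (m * u) = (d [^] m) [^] u" using dc by (simp add: nat_pow_pow)
    finally have "d = (d [^] m) [^] u" using dc by simp
    with subgroup_nat_pow_closed[OF C(1) m] dC show False by metis
  qed
  have le: "i = j" if "d [^] i \<otimes> k = d [^] j \<otimes> k'" "k \<in> C" "k' \<in> C" "i \<le> j" "j < p" for i j k k'
  proof (rule ccontr)
    assume "i \<noteq> j"
    have "d [^] j = d [^] i \<otimes> d [^] (j - i)" using dc that(4) by (simp add: nat_pow_mult)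
    with that(1) have "d [^] i \<otimes> k = d [^] i \<otimes> (d [^] (j - i) \<otimes> k')"
      using dc Cc that(2,3) by (simp add: m_assoc)
    hence "k = d [^] (j - i) \<otimes> k'" using dc Cc that(2,3) by simp
    hence "d [^] (j - i) = k \<otimes> inv k'" using dc Cc that(2,3) by (simp add: m_assoc)
    hence "d [^] (j - i) \<in> C" using that(2,3) Cm Ci by simp
    thus False using pow_notin[of "j - i"] \<open>i \<noteq> j\<close> that by simp
  qed
  let ?f = "\<lambda>(i, k). d [^] (i::nat) \<otimes> k"
  have inj: "inj_on ?f ({..<p} \<times> C)"
  proof -
    have "i = j \<and> k = k'"
      if "d [^] i \<otimes> k = d [^] j \<otimes> k'" "i < p" "j < p" "k \<in> C" "k' \<in> C" for i j k k'
    proof -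
      have "i = j"
      proof (cases "i \<le> j")
        case True
        with le[OF that(1)] that(2-) show ?thesis by simp
      next
        case False
        with le[OF that(1)[symmetric]] that(2-) show ?thesis by simp
      qed
      with that dc Cc show ?thesis by simp
    qed
    thus ?thesis by (intro inj_onI) auto
  qed
  have "?f ` ({..<p} \<times> C) \<subseteq> carrier G" using dc Cc by auto
  moreover have "card (?f ` ({..<p} \<times> C)) = card (carrier G)"
    using card_image[OF inj] order C(2)
    by (simp add: card_cartesian_product Coset.order_def power2_eq_square)
  ultimately have "?f ` ({..<p} \<times> C) = carrier G" using fin by (intro card_subset_eq)
  with g have "g \<in> ?f ` ({..<p} \<times> C)" by simp
  then obtain i k where ik: "k \<in> C" "g = d [^] (i::nat) \<otimes> k" by auto
  have ci: "c [^] i \<in> C" by (rule subgroup_nat_pow_closed[OF C(1) c])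
  \<comment> \<open>Here \<open>d [^] i\<close> is expanded as a conjugate of
    \<open>c [^] i\<close>. The leading \<open>g\<close> then cancels, which leaves
    \<open>inv g\<close> as a product of elements of \<open>C\<close>.\<close>
  have "g = g \<otimes> (c [^] i \<otimes> inv g \<otimes> k)"
    using ik(2) g cc Cc[OF ik(1)] by (simp add: d_pow m_assoc)
  hence "g \<otimes> \<one> = g \<otimes> (c [^] i \<otimes> inv g \<otimes> k)" using g by simp
  hence one: "c [^] i \<otimes> inv g \<otimes> k = \<one>" using g cc Cc[OF ik(1)] by simp
  have "inv g = inv (c [^] i) \<otimes> (c [^] i \<otimes> inv g \<otimes> k) \<otimes> inv k"
    using g cc Cc[OF ik(1)] by (simp add: m_assoc inv_cancel_left)
  also have "\<dots> \<in> C" unfolding one using Ci[OF ci] Ci[OF ik(1)] Cm subgroup.one_closed[OF C(1)] by simp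
  finally have "g \<in> C" using Ci[of "inv g"] g by simp
  thus False using dC Cm[OF Cm[OF _ c] Ci] by (simp add: d_def)
qed

text \<open>An element of order \<open>p ^ 2\<close> would generate \<open>G\<close>, so otherwise
  every nontrivial element generates a subgroup of order \<open>p\<close>, and these subgroups are
  normal. The commutator of \<open>x\<close> and \<open>y\<close> then lies in both cyclic
  subgroups, which meet trivially unless \<open>y\<close> is a power of \<open>x\<close>.\<close>

lemma comm_group_prime_square_order:
  assumes fin: "finite (carrier G)" and p: "prime p" and order: "Coset.order G = p ^ 2"
  shows "comm_group G"
proof (rule ccontr)
  assume nc: "\<not> comm_group G"
  have ord: "ord x = p" if x: "x \<in> carrier G" "x \<noteq> \<one>" for x
  proof -
    have "ord x dvd p ^ 2" using ord_dvd_group_order[OF x(1)] order by simp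
    then obtain i where i: "i \<le> 2" "ord x = p ^ i" using p by (metis divides_primepow_nat)
    have "i \<noteq> 0" using i ord_eq_1[OF x(1)] x by auto
    moreover have "i \<noteq> 2"
    proof
      assume "i = 2"
      hence "card (generate G {x}) = card (carrier G)"
        using i order generate_pow_card[OF x(1)] by (simp add: Coset.order_def)
      moreover have "generate G {x} \<subseteq> carrier G" using x generate_incl by simp
      ultimately have "generate G {x} = carrier G" using fin by (intro card_subset_eq)
      hence "comm_group G"
        using comm_group_if_powers[OF x(1)] generate_pow_on_finite_carrier[OF fin x(1)] by blast
      with nc show False ..
    qed
    ultimately have "i = 1" using i by simp
    with i show ?thesis by simp
  qed
  have "x \<otimes> y = y \<otimes> x" if x: "x \<in> carrier G" and y: "y \<in> carrier G" for x y
  proof (cases "x = \<one> \<or> y \<in> generate G {x} \<or> y = \<one>")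
    case True
    then show ?thesis
    proof (elim disjE)
      assume "y \<in> generate G {x}"
      then obtain i :: nat where "y = x [^] i" using generate_pow_on_finite_carrier[OF fin x] by blast
      thus ?thesis using x by (metis nat_pow_Suc nat_pow_Suc2)
    qed (use x y in auto)
  next
    case False
    have sub: "subgroup (generate G {z}) G" "z \<in> generate G {z}" if "z \<in> carrier G" for z
      using generate_is_subgroup that by (auto intro: generate.incl)
    have cx: "card (generate G {x}) = p" "card (generate G {y}) = p"
      using ord x y False generate_pow_card by simp_all
    note normal = normal_prime_subgroup_of_prime_square[OF fin p order]
    define w where "w = x \<otimes> y \<otimes> inv x \<otimes> inv y"
    have wc: "w \<in> carrier G" using x y by (simp add: w_def)
    have "x \<otimes> y \<otimes> inv x \<in> generate G {y}" using normal[OF sub(1)[OF y] cx(2) x sub(2)[OF y]] .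
    hence wy: "w \<in> generate G {y}" unfolding w_def
      using subgroup.m_closed[OF sub(1)[OF y]] subgroup.m_inv_closed[OF sub(1)[OF y] sub(2)[OF y]] by simp
    have "y \<otimes> inv x \<otimes> inv y \<in> generate G {x}"
      using normal[OF sub(1)[OF x] cx(1) y subgroup.m_inv_closed[OF sub(1)[OF x] sub(2)[OF x]]] .
    hence "x \<otimes> (y \<otimes> inv x \<otimes> inv y) \<in> generate G {x}"
      using subgroup.m_closed[OF sub(1)[OF x] sub(2)[OF x]] by simp
    hence wx: "w \<in> generate G {x}" unfolding w_def using x y by (simp add: m_assoc)
    have "w = \<one>"
    proof (rule ccontr)
      assume "w \<noteq> \<one>"
      have "generate G {w} = generate G {z}" if "z \<in> {x, y}" for z
        using that x y p cx wx wy \<open>w \<noteq> \<one>\<close>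
        by (intro ord_prime_subgroup(2)[OF fin sub(1)]) (elim insertE emptyE; simp)+
      from this[of x] this[of y] have "generate G {x} = generate G {y}" by simp
      with sub(2)[OF y] False show False by simp
    qed
    moreover have "x \<otimes> y = w \<otimes> (y \<otimes> x)"
      using x y by (simp add: w_def m_assoc inv_cancel_left)
    ultimately show ?thesis using x y by simp
  qed
  hence "comm_group G" by (rule group_comm_groupI)
  with nc show False ..
qed

end

text \<open>Otherwise \<open>g \<otimes> g\<close> generates \<open>C\<close>, so \<open>C\<close>
  and its other coset both consist of powers of \<open>g\<close>, and \<open>G\<close> would be
  cyclic.\<close>

lemma (in group) involutions_outside_prime_subgroup:
  assumes fin: "finite (carrier G)" and C: "subgroup C G" and p: "prime (card C)"
    and order: "Coset.order G = 2 * card C" and nc: "\<not> comm_group G"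
    and g: "g \<in> carrier G" "g \<notin> C"
  shows "g \<otimes> g = \<one>"
proof (rule ccontr)
  assume n1: "g \<otimes> g \<noteq> \<one>"
  note mem = index_two_mult_mem[OF fin C order]
  have gg: "g \<otimes> g \<in> C" using mem g by blast
  have pow: "\<exists>i::nat. c = g [^] i" if c: "c \<in> C" for c
  proof -
    obtain i :: nat where "c = (g \<otimes> g) [^] i"
      using prime_subgroup_powers[OF fin C p gg n1 c] .
    moreover have "g \<otimes> g = g [^] (2::nat)" using g by (simp add: numeral_2_eq_2)
    ultimately show ?thesis using g by (metis nat_pow_pow)
  qed
  have "\<exists>i::nat. x = g [^] i" if x: "x \<in> carrier G" for x
  proof (cases "x \<in> C")
    case False
    have "inv g \<notin> C" using g subgroup.m_inv_closed[OF C, of "inv g"] by auto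
    hence "x \<otimes> inv g \<in> C" using mem x False g by simp
    then obtain i :: nat where "x \<otimes> inv g = g [^] i" using pow by blast
    hence "x = g [^] i \<otimes> g" using x g by (metis inv_solve_right' nat_pow_closed)
    hence "x = g [^] Suc i" by simp
    thus ?thesis by blast
  qed (rule pow)
  with nc comm_group_if_powers[OF g(1)] show False by blast
qed

section \<open>Dihedral groups\<close>

text \<open>For \<open>a\<close> on the unit circle this is a plane rotation written in its complex
  eigenbasis; in the same basis a reflection becomes antidiagonal and exchanges the two
  eigenlines.\<close>

definition rot :: "complex \<Rightarrow> complex mat" where
  "rot a = mat 2 2 (\<lambda>(i, j). if i = j then if i = 0 then a else inverse a else 0)"

definition reflect :: "complex \<Rightarrow> complex mat" where
  "reflect a = mat 2 2 (\<lambda>(i, j). if i = j then 0 else if i = 0 then a else inverse a)"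

lemma rot_reflect_carrier [simp]: "rot a \<in> carrier_mat 2 2" "reflect a \<in> carrier_mat 2 2"
  by (simp_all add: rot_def reflect_def)

lemma rot_reflect_mult:
  "rot a * rot b = rot (a * b)"
  "rot a * reflect b = reflect (a * b)"
  "reflect a * rot b = reflect (a * inverse b)"
  "reflect a * reflect b = rot (a * inverse b)"
  "rot 1 = 1\<^sub>m 2"
  by (auto intro!: eq_matI simp: rot_def reflect_def scalar_prod_def numeral_2_eq_2 less_Suc_eq)

lemma rot_reflect_GL:
  assumes "a \<noteq> 0"
  shows "rot a \<in> carrier (GL 2)" "reflect a \<in> carrier (GL 2)"
  unfolding GL_carrier using assms
  by (auto intro: bexI[of _ "rot (inverse a)"] simp: rot_reflect_mult)
    (auto intro: bexI[of _ "reflect a"] simp: rot_reflect_mult)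

lemma rot_reflect_mult_vec:
  assumes "v \<in> carrier_vec 2"
  shows "rot a *\<^sub>v v = vec 2 (\<lambda>i. if i = 0 then a * v $ 0 else inverse a * v $ 1)"
    and "reflect a *\<^sub>v v = vec 2 (\<lambda>i. if i = 0 then a * v $ 1 else inverse a * v $ 0)"
  using assms
  by (auto intro!: eq_vecI simp: rot_def reflect_def scalar_prod_def numeral_2_eq_2 less_Suc_eq)

text \<open>\<open>s\<close> is a reference reflection: each \<open>g\<close> outside
  \<open>C\<close> equals \<open>(g \<otimes> s) \<otimes> s\<close> with
  \<open>g \<otimes> s\<close> in \<open>C\<close>, which serves as the coordinate of
  \<open>g\<close>.\<close>

locale dihedral = group G for G (structure) +
  fixes C s
  assumes fin: "finite (carrier G)" and C: "subgroup C G" and prime: "prime (card C)"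
    and odd: "odd (card C)" and order: "Coset.order G = 2 * card C"
    and invol: "\<And>g. g \<in> carrier G \<Longrightarrow> g \<notin> C \<Longrightarrow> g \<otimes> g = \<one>"
    and s: "s \<in> carrier G" "s \<notin> C"
begin

lemmas C_carrier = subgroup.mem_carrier[OF C]
  and C_mult = subgroup.m_closed[OF C]
  and C_inv = subgroup.m_inv_closed[OF C]
  and out_out = index_two_mult_mem[OF fin C order]

lemma inv_out: "g \<in> carrier G \<Longrightarrow> g \<notin> C \<Longrightarrow> inv g = g"
  using invol by (simp add: inv_equality)

lemma in_out:
  assumes "c \<in> C" "g \<in> carrier G" "g \<notin> C"
  shows "c \<otimes> g \<notin> C"
proof
  assume "c \<otimes> g \<in> C"
  hence "inv c \<otimes> (c \<otimes> g) \<in> C" using assms C_inv C_mult by blast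
  with assms C_carrier show False by (simp add: inv_cancel_left)
qed

text \<open>\<open>inv c \<otimes> g\<close> lies outside \<open>C\<close>, so it is its own
  inverse, and that inverse is \<open>g \<otimes> c\<close>.\<close>

lemma out_in_eq:
  assumes "g \<in> carrier G" "g \<notin> C" "c \<in> C"
  shows "g \<otimes> c = inv c \<otimes> g"
proof -
  have ic: "inv c \<in> C" "inv c \<in> carrier G" "c \<in> carrier G" using assms C_inv C_carrier by auto
  have "inv (inv c \<otimes> g) = inv c \<otimes> g"
    using in_out[OF ic(1) assms(1,2)] ic assms by (intro inv_out) simp_all
  moreover have "inv (inv c \<otimes> g) = g \<otimes> c"
    using ic assms inv_out by (simp add: inv_mult_group)
  ultimately show ?thesis by simp
qed

lemma out_in:
  assumes "g \<in> carrier G" "g \<notin> C" "c \<in> C"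
  shows "g \<otimes> c \<notin> C"
  using out_in_eq[OF assms] in_out[OF C_inv assms(1,2)] assms by simp

text \<open>The representation induced from the character \<open>\<chi>\<close> of \<open>C\<close>.\<close>

definition ind_rep :: "('a \<Rightarrow> complex) \<Rightarrow> 'a \<Rightarrow> complex mat" where
  "ind_rep \<chi> g = (if g \<in> C then rot (\<chi> g) else reflect (\<chi> (g \<otimes> s)))"

text \<open>Each of the four cases for \<open>g\<close> and \<open>h\<close> matches one product
  rule of \<open>rot_reflect_mult\<close>; what must be checked is the coordinate in
  \<open>C\<close> of the product.\<close>

lemma ind_rep_hom:
  assumes \<chi>: "\<chi> \<in> linear_chars G C"
  shows "ind_rep \<chi> \<in> hom G (GL 2)"
proof -
  have nz: "\<chi> x \<noteq> 0" and mult: "y \<in> C \<Longrightarrow> \<chi> (x \<otimes> y) = \<chi> x * \<chi> y" if "x \<in> C" for x y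
    using \<chi> that by (auto simp: linear_chars_def)
  have "ind_rep \<chi> g \<in> carrier (GL 2)" if "g \<in> carrier G" for g
    using that nz s out_out by (simp add: ind_rep_def rot_reflect_GL)
  moreover have "ind_rep \<chi> (g \<otimes> h) = ind_rep \<chi> g * ind_rep \<chi> h"
    if g: "g \<in> carrier G" and h: "h \<in> carrier G" for g h
  proof (cases "g \<in> C"; cases "h \<in> C")
    assume "g \<in> C" "h \<in> C"
    thus ?thesis using C_mult mult by (simp add: ind_rep_def rot_reflect_mult)
  next
    assume a: "g \<in> C" "h \<notin> C"
    have "\<chi> (g \<otimes> h \<otimes> s) = \<chi> g * \<chi> (h \<otimes> s)"
      using mult[OF a(1) out_out[OF h a(2) s]] g h s by (simp add: m_assoc)
    thus ?thesis using a in_out[OF a(1) h a(2)] by (simp add: ind_rep_def rot_reflect_mult)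
  next
    assume a: "g \<notin> C" "h \<in> C"
    \<comment> \<open>Moving \<open>h\<close> past the reflection \<open>s\<close> inverts
      it.\<close>
    have "g \<otimes> h \<otimes> s = (g \<otimes> s) \<otimes> inv h"
      using out_in_eq[OF s C_inv[OF a(2)]] g h s by (simp add: m_assoc)
    hence "\<chi> (g \<otimes> h \<otimes> s) = \<chi> (g \<otimes> s) * inverse (\<chi> h)"
      using mult[OF out_out[OF g a(1) s] C_inv[OF a(2)]] linear_char_inv[OF C \<chi> a(2)] by simp
    thus ?thesis using a out_in[OF g a] by (simp add: ind_rep_def rot_reflect_mult)
  next
    assume a: "g \<notin> C" "h \<notin> C"
    have "(g \<otimes> s) \<otimes> inv (h \<otimes> s) = g \<otimes> inv h"
      using g h s by (simp add: inv_mult_group m_assoc inv_cancel_left)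
    hence "g \<otimes> h = (g \<otimes> s) \<otimes> inv (h \<otimes> s)" using inv_out[OF h a(2)] by simp
    hence "\<chi> (g \<otimes> h) = \<chi> (g \<otimes> s) * inverse (\<chi> (h \<otimes> s))"
      using mult[OF out_out[OF g a(1) s] C_inv[OF out_out[OF h a(2) s]]]
        linear_char_inv[OF C \<chi> out_out[OF h a(2) s]] by simp
    thus ?thesis using a out_out[OF g a(1) h a(2)] by (simp add: ind_rep_def rot_reflect_mult)
  qed
  ultimately show ?thesis by (auto simp: hom_def GL_simps(2))
qed

text \<open>The condition on \<open>r\<close> gives \<open>rot (\<chi> r)\<close> two distinct
  eigenvalues, so a nonzero invariant subspace contains one of the two unit vectors, and the image
  of \<open>s\<close> swaps them.\<close>

lemma ind_rep_irrep:
  assumes \<chi>: "\<chi> \<in> linear_chars G C" and r: "r \<in> C" "\<chi> r \<noteq> inverse (\<chi> r)"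
  shows "(2, ind_rep \<chi>) \<in> irreps G"
proof -
  have "W = {0\<^sub>v 2} \<or> W = carrier_vec 2" if "invariant_subspace G 2 (ind_rep \<chi>) W" for W
  proof (cases "W = {0\<^sub>v 2}")
    case False
    note W = invariant_subspaceD[OF that]
    define a where "a = \<chi> r"
    obtain w where w: "w \<in> W" "w \<noteq> 0\<^sub>v 2" using False W(2) by blast
    have wc: "w \<in> carrier_vec 2" using w W(1) by blast
    have w01: "w $ 0 \<noteq> 0 \<or> w $ 1 \<noteq> 0"
    proof (rule ccontr)
      assume "\<not> ?thesis"
      hence "w = 0\<^sub>v 2" using wc by (intro eq_vecI) (auto simp: less_2_cases_iff)
      with w show False by simp
    qed
    have swap: "reflect 1 *\<^sub>v v \<in> W" if "v \<in> W" for v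
      using W(5)[OF s(1) that] s invol linear_char_one[OF C \<chi>] by (simp add: ind_rep_def)
    have "rot a *\<^sub>v w \<in> W"
      using W(5)[OF C_carrier[OF r(1)] w(1)] r by (simp add: ind_rep_def a_def)
    hence comb: "rot a *\<^sub>v w + d \<cdot>\<^sub>v w \<in> W" for d
      using W(3,4) w(1) by blast
    have a: "a - inverse a \<noteq> 0" "inverse a - a \<noteq> 0" using r by (simp_all add: a_def)
    have "unit_vec 2 0 \<in> W \<or> unit_vec 2 1 \<in> W"
    proof (cases "w $ 0 = 0")
      case False
      define k where "k = (a - inverse a) * w $ 0"
      \<comment> \<open>Subtracting \<open>inverse a\<close> times \<open>w\<close> kills the second
        coordinate and keeps a nonzero multiple of the first.\<close>
      have "rot a *\<^sub>v w + (- inverse a) \<cdot>\<^sub>v w = k \<cdot>\<^sub>v unit_vec 2 0"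
        using wc by (intro eq_vecI)
          (auto simp: rot_reflect_mult_vec less_2_cases_iff k_def left_diff_distrib)
      hence "k \<cdot>\<^sub>v unit_vec 2 0 \<in> W" using comb[of "- inverse a"] by simp
      moreover have "k \<noteq> 0" using False a by (simp add: k_def)
      ultimately show ?thesis using W(4)[of "k \<cdot>\<^sub>v unit_vec 2 0" "1 / k"] by (simp add: smult_smult_assoc)
    next
      case True
      define k where "k = (inverse a - a) * w $ 1"
      have "rot a *\<^sub>v w + (- a) \<cdot>\<^sub>v w = k \<cdot>\<^sub>v unit_vec 2 1"
        using wc by (intro eq_vecI)
          (auto simp: rot_reflect_mult_vec less_2_cases_iff k_def left_diff_distrib)
      hence "k \<cdot>\<^sub>v unit_vec 2 1 \<in> W" using comb[of "- a"] by simp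
      moreover have "k \<noteq> 0" using True w01 a by (simp add: k_def)
      ultimately show ?thesis using W(4)[of "k \<cdot>\<^sub>v unit_vec 2 1" "1 / k"] by (simp add: smult_smult_assoc)
    qed
    moreover have "reflect 1 *\<^sub>v unit_vec 2 0 = unit_vec 2 1" "reflect 1 *\<^sub>v unit_vec 2 1 = unit_vec 2 0"
      by (auto intro!: eq_vecI simp: rot_reflect_mult_vec less_2_cases_iff)
    ultimately have units: "unit_vec 2 0 \<in> W" "unit_vec 2 1 \<in> W" using swap by metis+
    have "v \<in> W" if v: "v \<in> carrier_vec 2" for v
    proof -
      have "v = v $ 0 \<cdot>\<^sub>v unit_vec 2 0 + v $ 1 \<cdot>\<^sub>v unit_vec 2 1"
        using v by (intro eq_vecI) (auto simp: less_2_cases_iff)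
      thus ?thesis using W(3)[OF W(4)[OF units(1)] W(4)[OF units(2)]] by metis
    qed
    thus ?thesis using W(1) by blast
  qed simp
  thus ?thesis using ind_rep_hom[OF \<chi>] by (simp add: irreps_def irreducible_rep_def)
qed

text \<open>Isomorphic representations give \<open>r\<close> the same eigenvalues. Concretely, if
  \<open>\<psi> r\<close> were neither of the two eigenvalues on the other side, the first row of
  the intertwiner would vanish.\<close>

lemma ind_rep_iso:
  assumes "((2, ind_rep \<chi>), (2, ind_rep \<psi>)) \<in> rep_iso G" and r: "r \<in> C"
  shows "\<psi> r = \<chi> r \<or> \<psi> r = inverse (\<chi> r)"
proof (rule ccontr)
  assume ne: "\<not> ?thesis"
  have "\<exists>P\<in>carrier (GL 2). P * ind_rep \<chi> r = ind_rep \<psi> r * P"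
    using assms(1) C_carrier[OF r] unfolding rep_iso_def by blast
  then obtain P where P: "P \<in> carrier (GL 2)" "P * rot (\<chi> r) = rot (\<psi> r) * P"
    using r by (auto simp: ind_rep_def)
  then obtain Q where Q: "P \<in> carrier_mat 2 2" "Q \<in> carrier_mat 2 2" "P * Q = 1\<^sub>m 2"
    by (auto simp: GL_carrier)
  have "P $$ (0, 0) * \<chi> r = \<psi> r * P $$ (0, 0)"
    using arg_cong[OF P(2), of "\<lambda>M. M $$ (0, 0)"] Q(1)
    by (simp add: scalar_prod_def numeral_2_eq_2 rot_def)
  moreover have "P $$ (0, 1) * inverse (\<chi> r) = \<psi> r * P $$ (0, 1)"
    using arg_cong[OF P(2), of "\<lambda>M. M $$ (0, 1)"] Q(1)
    by (simp add: scalar_prod_def numeral_2_eq_2 rot_def)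
  ultimately have "P $$ (0, 0) = 0" "P $$ (0, 1) = 0" using ne by auto
  hence "(P * Q) $$ (0, 0) = 0"
    by (subst index_mult_mat_sum[OF Q(1,2)]) (auto simp: numeral_2_eq_2)
  thus False using Q(3) by simp
qed

text \<open>\<open>C\<close> is regarded as a group of its own, commutative by its prime order; it
  has \<open>card C > 1\<close> characters, and these cannot all be trivial.\<close>

lemma nontrivial_char:
  obtains \<chi> r where "\<chi> \<in> linear_chars G C" "r \<in> C" "\<chi> r \<noteq> 1"
proof -
  let ?C = "G\<lparr>carrier := C\<rparr>"
  have "group ?C" by (rule subgroup.subgroup_is_group[OF C group_axioms])
  moreover have finC: "finite (carrier ?C)" using fin subgroup.subset[OF C] finite_subset by auto
  ultimately interpret CC: comm_group ?C
    using prime by (intro group.comm_group_prime_order) (auto simp: Coset.order_def)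
  obtain F where F: "finite F" "F \<subseteq> linear_chars ?C (carrier ?C)" "card F = Coset.order ?C"
    using CC.linear_chars_abundant[OF finC] .
  have "card F > 1" using F(3) prime prime_gt_1_nat by (simp add: Coset.order_def)
  hence "\<not> F \<subseteq> {\<lambda>x\<in>C. 1}" using card_mono[of "{\<lambda>x\<in>C. 1::complex}" F] by auto
  then obtain \<chi> where \<chi>: "\<chi> \<in> F" "\<chi> \<noteq> (\<lambda>x\<in>C. 1)" by blast
  have \<chi>C: "\<chi> \<in> linear_chars G C" using \<chi>(1) F(2) by (auto simp: linear_chars_def)
  have "\<exists>r\<in>C. \<chi> r \<noteq> 1"
  proof (rule ccontr)
    assume "\<not> ?thesis"
    hence "\<chi> = (\<lambda>x\<in>C. 1)"
      using \<chi>C by (intro extensionalityI[of _ C]) (auto simp: linear_chars_def)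
    with \<chi> show False by simp
  qed
  with \<chi>C that show thesis by blast
qed

lemma T_ge: "T G \<ge> card C + 1"
proof -
  define p where "p = card C"
  obtain \<chi> r where \<chi>: "\<chi> \<in> linear_chars G C" and r: "r \<in> C" "\<chi> r \<noteq> 1"
    by (rule nontrivial_char)
  define z where "z = \<chi> r"
  have z0: "z \<noteq> 0" using \<chi> r by (auto simp: z_def linear_chars_def)
  have "r \<noteq> \<one>" using r linear_char_one[OF C \<chi>] by auto
  hence "ord r = p" using ord_prime_subgroup(1)[OF fin C prime r(1)] by (simp add: p_def)
  hence "r [^] p = \<one>" using pow_ord_eq_1[OF C_carrier[OF r(1)]] by simp
  hence zp: "z ^ p = 1"
    using linear_char_pow[OF C \<chi> r(1), of p] linear_char_one[OF C \<chi>] by (simp add: z_def)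
  \<comment> \<open>\<open>z\<close> is a primitive \<open>p\<close>-th root of unity.\<close>
  have z_pow: "z ^ m \<noteq> 1" if "0 < m" "m < p" for m
  proof
    assume m: "z ^ m = 1"
    have "coprime m p" using that prime
      by (metis coprime_commute dvd_imp_le not_less p_def prime_imp_coprime)
    hence "\<exists>u v. m * u = p * v + 1" using bezout_nat[of m p] that by auto
    then obtain u v where uv: "m * u = p * v + 1" by blast
    have "(z ^ m) ^ u = (z ^ p) ^ v * z"
      unfolding power_mult[symmetric] uv by simp
    with m zp r show False by (simp add: z_def)
  qed
  \<comment> \<open>Exponents \<open>j\<close> and \<open>p - j\<close> give isomorphic
    representations, so only those from 1 to \<open>h\<close> are used; a sum of two of them stays
    below \<open>p\<close>, where no positive power of \<open>z\<close> is 1.\<close>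
  define h where "h = (p - 1) div 2"
  have ph: "p = 2 * h + 1" using odd by (auto simp: h_def p_def elim!: oddE)
  define \<psi> where "\<psi> j = (\<lambda>x\<in>C. \<chi> x ^ j)" for j :: nat
  have \<psi>: "\<psi> j \<in> linear_chars G C" for j
    using \<chi> C_mult by (auto simp: linear_chars_def \<psi>_def power_mult_distrib)
  have \<psi>r: "\<psi> j r = z ^ j" for j using r by (simp add: \<psi>_def z_def)
  have irr2: "(2, ind_rep (\<psi> j)) \<in> irreps G" if "j \<in> {1..h}" for j
  proof (rule ind_rep_irrep[OF \<psi> r(1)])
    show "\<psi> j r \<noteq> inverse (\<psi> j r)"
    proof
      assume "\<psi> j r = inverse (\<psi> j r)"
      hence "z ^ (j + j) = 1" using z0 unfolding power_add \<psi>r by (metis right_inverse power_not_zero)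
      thus False using z_pow[of "j + j"] that ph by simp
    qed
  qed
  have iso2: "j = k" if jk: "j \<in> {1..h}" "k \<in> {1..h}"
    and iso: "((2, ind_rep (\<psi> j)), (2, ind_rep (\<psi> k))) \<in> rep_iso G" for j k
  proof -
    have "z ^ k \<noteq> inverse (z ^ j)"
    proof
      assume "z ^ k = inverse (z ^ j)"
      hence "z ^ (j + k) = 1" using z0 by (simp add: power_add)
      thus False using z_pow[of "j + k"] jk ph by simp
    qed
    hence eq: "z ^ j = z ^ k" using ind_rep_iso[OF iso r(1)] by (simp add: \<psi>r)
    have "\<not> a < b" if "z ^ a = z ^ b" "b \<le> h" for a b
    proof
      assume "a < b"
      hence "z ^ b = z ^ a * z ^ (b - a)" by (simp add: power_add[symmetric])
      hence "z ^ (b - a) = 1" using that(1) z0 by simp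
      thus False using z_pow[of "b - a"] \<open>a < b\<close> that(2) ph by simp
    qed
    from this[of j k] this[of k j] eq jk show ?thesis by simp
  qed
  define D where "D = {\<lambda>g\<in>carrier G. 1 :: complex, \<lambda>g\<in>carrier G. if g \<in> C then 1 else - 1}"
  have D: "D \<subseteq> linear_chars G (carrier G)"
    using C_mult in_out out_in out_out by (auto simp: D_def linear_chars_def)
  have "(\<lambda>g\<in>carrier G. 1 :: complex) \<noteq> (\<lambda>g\<in>carrier G. if g \<in> C then 1 else - 1)"
  proof
    assume "(\<lambda>g\<in>carrier G. 1 :: complex) = (\<lambda>g\<in>carrier G. if g \<in> C then 1 else - 1)"
    from fun_cong[OF this, of s] show False using s by simp
  qed
  hence card_D: "card D = 2" by (simp add: D_def)
  let ?r1 = "\<lambda>\<chi>. (1::nat, \<lambda>g::'a. mat 1 1 (\<lambda>_. \<chi> g :: complex))"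
  let ?r2 = "\<lambda>j. (2::nat, ind_rep (\<psi> j))"
  have inj1: "inj_on ?r1 D" using inj_linear_char_rep by (rule inj_on_subset) simp
  have inj2: "inj_on ?r2 {1..h}"
  proof (rule inj_onI)
    fix j k assume jk: "j \<in> {1..h}" "k \<in> {1..h}" "?r2 j = ?r2 k"
    \<comment> \<open>Equal representations are isomorphic, so \<open>iso2\<close> already separates
      them.\<close>
    have "(?r2 j, ?r2 j) \<in> rep_iso G"
      using equiv_rep_iso[of G] irr2[OF jk(1)] by (auto simp: equiv_def refl_on_def)
    hence "(?r2 j, ?r2 k) \<in> rep_iso G" by (simp only: jk(3))
    thus "j = k" by (rule iso2[OF jk(1,2)])
  qed
  let ?X = "?r1 ` D \<union> ?r2 ` {1..h}"
  have fin_D: "finite D" by (simp add: D_def)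
  have "(\<Sum>x\<in>?X. fst x) = (\<Sum>x\<in>?r1 ` D. fst x) + (\<Sum>x\<in>?r2 ` {1..h}. fst x)"
    using fin_D by (intro sum.union_disjoint) auto
  also have "(\<Sum>x\<in>?r1 ` D. fst x) = 2"
    by (subst sum.reindex[OF inj1]) (simp add: o_def card_D)
  also have "(\<Sum>x\<in>?r2 ` {1..h}. fst x) = 2 * h"
    by (subst sum.reindex[OF inj2]) (simp add: o_def)
  also have "2 + 2 * h = card C + 1" using ph by (simp add: p_def)
  finally have "card C + 1 = (\<Sum>x\<in>?X. fst x)" ..
  also have "\<dots> \<le> T G"
  proof (rule T_ge_sum_degrees[OF group_axioms fin])
    show "finite ?X" using fin_D by simp
    show "?X \<subseteq> irreps G"
      using linear_char_irrep[of _ G] irr2 D by (intro Un_least image_subsetI) blast+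
    show "x = y" if "x \<in> ?X" "y \<in> ?X" and iso: "(x, y) \<in> rep_iso G" for x y
    proof -
      \<comment> \<open>The degree keeps the two families apart.\<close>
      have "fst x = fst y" using iso by (auto simp: rep_iso_def)
      hence "(x \<in> ?r1 ` D \<and> y \<in> ?r1 ` D) \<or> (x \<in> ?r2 ` {1..h} \<and> y \<in> ?r2 ` {1..h})"
        using that(1,2) by auto
      thus ?thesis
      proof (elim disjE conjE imageE)
        fix \<phi> \<psi> assume a: "x = ?r1 \<phi>" "y = ?r1 \<psi>" "\<phi> \<in> D" "\<psi> \<in> D"
        have "\<phi> = \<psi>" by (rule linear_char_rep_iso[of _ G]) (use a D iso in auto)
        with a show ?thesis by simp
      next
        fix j k assume "x = ?r2 j" "y = ?r2 k" "j \<in> {1..h}" "k \<in> {1..h}"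
        moreover from this have "j = k" using iso by (intro iso2) simp_all
        ultimately show ?thesis by simp
      qed
    qed
  qed
  finally show ?thesis .
qed

section \<open>Elements inverted by a homomorphism\<close>

lemma card_inverted_le:
  assumes \<alpha>: "\<alpha> \<in> hom G G"
  shows "card {g \<in> carrier G. \<alpha> g = inv g} \<le> card C + 1"
proof -
  define S where "S = {g \<in> carrier G. \<alpha> g = inv g}"
  have finC: "finite C" using fin subgroup.subset[OF C] finite_subset by blast
  have finS: "finite S" using fin by (simp add: S_def)
  have cS: "card S = card (S \<inter> C) + card (S - C)"
    using finS by (metis card_Int_Diff)
  \<comment> \<open>If \<open>\<alpha>\<close> inverts some \<open>c \<noteq> \<one>\<close> of \<open>C\<close>, at most one element outside \<open>C\<close> is fixed by \<open>\<alpha>\<close>: the product of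
    two would be a fixed generator of \<open>C\<close>, making \<open>c\<close> an involution.\<close>
  show ?thesis
  proof (cases "S \<inter> C \<subseteq> {\<one>}")
    case True
    hence "card (S \<inter> C) \<le> 1" using card_mono[of "{\<one>}"] by auto
    moreover have "card (S - C) \<le> card (carrier G - C)"
      using fin by (intro card_mono) (auto simp: S_def)
    moreover have "card (carrier G - C) = card C"
      using order finC subgroup.subset[OF C] by (simp add: card_Diff_subset Coset.order_def)
    ultimately show ?thesis using cS by (simp add: S_def)
  next
    case False
    then obtain c where c: "c \<in> C" "c \<noteq> \<one>" "\<alpha> c = inv c" by (auto simp: S_def)
    note cc = C_carrier[OF c(1)]
    have "t = u" if t: "t \<in> S - C" and u: "u \<in> S - C" for t u
    proof (rule ccontr)
      assume "t \<noteq> u"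
      have tu: "t \<in> carrier G" "u \<in> carrier G" "t \<notin> C" "u \<notin> C" using t u by (auto simp: S_def)
      \<comment> \<open>Outside \<open>C\<close> every element is its own inverse, so inverted means
        fixed.\<close>
      have fix_tu: "\<alpha> t = t" "\<alpha> u = u" using t u inv_out by (auto simp: S_def)
      have mem: "t \<otimes> u \<in> C" using out_out tu by blast
      have "t \<otimes> u \<noteq> \<one>"
      proof
        assume "t \<otimes> u = \<one>"
        hence "t = inv u" using tu by (metis inv_equality)
        thus False using \<open>t \<noteq> u\<close> inv_out tu by simp
      qed
      then obtain i :: nat where i: "c = (t \<otimes> u) [^] i"
        using prime_subgroup_powers[OF fin C prime mem _ c(1)] by blast
      have "\<alpha> (t \<otimes> u) = t \<otimes> u" using \<alpha> tu fix_tu by (simp add: hom_def)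
      hence "\<alpha> c = c"
        unfolding i using hom_nat_pow[OF \<alpha> _ group_axioms group_axioms, of "t \<otimes> u" i] tu by simp
      hence "c \<otimes> c = \<one>" using c(3) r_inv[OF cc] by simp
      hence "c [^] (2::nat) = \<one>" using cc by (simp add: numeral_2_eq_2)
      hence "card C dvd 2"
        using pow_eq_id[OF cc] ord_prime_subgroup(1)[OF fin C prime c(1,2)] by simp
      hence "card C = 1 \<or> card C = 2" using prime_nat_iff two_is_prime_nat by blast
      thus False using prime odd by auto
    qed
    hence "card (S - C) \<le> 1"
      using finS by (simp add: card_le_Suc0_iff_eq)
    moreover have "card (S \<inter> C) \<le> card C" using finC by (intro card_mono) auto
    ultimately show ?thesis using cS by (simp add: S_def)
  qed
qed

end

theorem theorem2p7:
  fixes G :: "('a, 'b) monoid_scheme" (structure)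
    and p :: nat
  assumes "prime p"
    and "group G"
    and "finite (carrier G)"
    and "Coset.order G = 2 * p \<or> Coset.order G = p \<or> Coset.order G = p ^ 2"
  shows "\<forall>\<alpha> \<in> auto G. T G \<ge> card {g \<in> carrier G. \<alpha> g = inv g}"
proof (rule ballI)
  interpret group G by fact
  fix \<alpha> assume \<alpha>: "\<alpha> \<in> auto G"
  show "T G \<ge> card {g \<in> carrier G. \<alpha> g = inv g}"
  proof (cases "comm_group G")
    case True
    have "card {g \<in> carrier G. \<alpha> g = inv g} \<le> Coset.order G"
      unfolding Coset.order_def using assms(3) by (intro card_mono) auto
    also have "\<dots> \<le> T G" using comm_group.T_ge_order[OF True assms(3)] .
    finally show ?thesis .
  next
    case False
    have "Coset.order G \<noteq> p" using False comm_group_prime_order[OF assms(3)] assms(1) by auto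
    moreover have n2: "Coset.order G \<noteq> p ^ 2"
      using False comm_group_prime_square_order[OF assms(3,1)] by auto
    ultimately have order: "Coset.order G = 2 * p" using assms(4) by simp
    \<comment> \<open>For \<open>p = 2\<close> the orders \<open>2 * p\<close> and
      \<open>p ^ 2\<close> coincide, and that case is already known to be abelian.\<close>
    have "p \<noteq> 2" using n2 order by auto
    hence odd: "odd p" using assms(1) primes_dvd_imp_eq two_is_prime_nat by blast
    obtain C where C: "subgroup C G" "card C = p"
      using sylow_thm[OF assms(1,2), of 1 2] order assms(3) by auto
    have "C \<noteq> carrier G" using C order assms(1) prime_gt_0_nat by (auto simp: Coset.order_def)
    then obtain s where s: "s \<in> carrier G" "s \<notin> C" using subgroup.subset[OF C(1)] by blast
    have invol: "g \<otimes> g = \<one>" if "g \<in> carrier G" "g \<notin> C" for g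
      using involutions_outside_prime_subgroup[OF assms(3) C(1) _ _ False that] assms(1) order C by simp
    interpret dihedral G C s
      by (intro dihedral.intro dihedral_axioms.intro group_axioms)
        (use assms(1,3) C odd order s invol in simp_all)
    have "\<alpha> \<in> hom G G" using \<alpha> by (simp add: auto_def)
    from card_inverted_le[OF this] T_ge show ?thesis by simp
  qed
qed

end
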